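(* Let $f\in\mathcal{C}^2(\mathbb{R}^2)$ be supported in $\mathbb{B}^\circ$ and let $M,N\in\mathbb{N}$. Then $$\left\|S_{M,N}^{K}(f)-S_{M,N}(f)\right\|_\infty=\mathcal{O}(1/K)\qquad\text{for } K\ge K[M,N],$$ that is, there is a constant $A>0$ such that the left-hand side is at most $A/K$ for every $K\in\mathbb{N}$ with $K\ge K[M,N]$.
   Context: $\mathbb{N}=\{1,2,\dots\}$. $\mathbb{B}^\circ$ is the open unit disk of $\mathbb{R}^2$; $\mathrm{supp}(f)=\{\mathbf{x}: f(\mathbf{x})\neq 0\}$ and $f$ is supported in $X$ if $\mathrm{supp}(f)\subseteq X$. $\|f\|_\infty=\sup_{\mathbf{x}}|f(\mathbf{x})|$. $\mathcal{C}^q(\mathbb{R}^2)$ is the set of functions $\mathbb{R}^2\to\mathbb{C}$ all of whose partial derivatives of order $\le q$ exist and are continuous. Bessel notation: $J_m$ is the Bessel function of the first kind of order $m\in\mathbb{Z}$, $0<z_{m,1}<z_{m,2}<\cdots$ are its positive zeros, $K_{m,n}:=\lceil z_{m,n}/\pi\rceil$, and $K[M,N]:=\max\{K_{m,n}:0\le m\le M,\ 1\le n\le N\}$. In polar coordinates, $\Psi_{m,n}(r,\theta)=\frac{e^{\mathrm{i}m\theta}J_m(z_{m,n}r)}{\sqrt{\pi}\,|J_{m+1}(z_{m,n})|}$ if $r\le 1$, and $0$ if $r>1$. The Fourier-Bessel coefficient is $C_{m,n}(f)=\int_0^{2\pi}\int_0^1 f(r,\theta)\overline{\Psi_{m,n}(r,\theta)}\,r\,dr\,d\theta$,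 and the partial sums are $S_{M,N}(f)=\sum_{m=-M}^M\sum_{n=1}^N C_{m,n}(f)\Psi_{m,n}$. Finite Fourier transform: for $L\in\mathbb{N}$, $\mathbf{k}\in\mathbb{Z}^2$, $\widehat f(\mathbf{k};L)=\delta^2\sum_{i=1}^L\sum_{j=1}^L f(x_i,x_j)e^{-\pi\mathrm{i}(k_1x_i+k_2x_j)}$ with $\delta=2/L$, $x_i=-1+(i-1)\delta$. Coefficients: for $\mathbf{k}=(k_1,k_2)\in\mathbb{Z}^2$, $\mathbf{c}(\mathbf{k};m,n)=\varepsilon_m\sqrt{\pi}(-1)^n\mathrm{i}^m z_{m,n}\frac{J_m(\pi\|\mathbf{k}\|_2)e^{-\mathrm{i}m\Phi(\mathbf{k})}}{2(\pi^2\|\mathbf{k}\|_2^2-z_{m,n}^2)}$, where $\varepsilon_m=1$ if $m\ge0$, $\varepsilon_m=(-1)^m$ if $m<0$, and $\Phi(\mathbf{k})=\mathrm{atan2}(k_2,k_1)$ is the polar angle of $\mathbf{k}$ (with value $0$ at $\mathbf{k}=0$). If $\pi\|\mathbf{k}\|_2=z_{m,n}$, the quotient $J_m(\pi\|\mathbf{k}\|_2)/(\pi^2\|\mathbf{k}\|_2^2-z_{m,n}^2)$ is understood as its limiting value $J_m'(z_{m,n})/(2z_{m,n})$. Finite and inverse finite Fourier-Bessel transforms of order $K\in\mathbb{N}$: $C_{m,n}^K(f)=\sum_{\mathbf{k}\in\mathbb{Z}^2,\ \|\mathbf{k}\|_\infty\le K}\mathbf{c}(\mathbf{k};m,n)\,\widehat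 f(\mathbf{k};2K+1)$ and $S_{M,N}^K(f)=\sum_{m=-M}^M\sum_{n=1}^N C_{m,n}^K(f)\Psi_{m,n}$. *)

theory Defs
  imports "HOL-Analysis.Analysis"
begin

fun C_class :: "nat \<Rightarrow> ('a::euclidean_space \<Rightarrow> 'b::real_normed_vector) \<Rightarrow> bool" where
  "C_class 0 f \<longleftrightarrow> continuous_on UNIV f"
| "C_class (Suc q) f \<longleftrightarrow> continuous_on UNIV f \<and>
     (\<forall>b\<in>Basis. (\<forall>x. (\<lambda>t::real. f (x + t *\<^sub>R b)) differentiable (at 0)) \<and>
        C_class q (\<lambda>x. vector_derivative (\<lambda>t::real. f (x + t *\<^sub>R b)) (at 0)))"

definition supp :: "('a \<Rightarrow> 'b::zero) \<Rightarrow> 'a set" where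
  "supp f = {x. f x \<noteq> 0}"

(* Valued in ennreal so that an unbounded function has norm infinity;
   a real-valued SUP would be unspecified there. *)
definition sup_norm :: "('a \<Rightarrow> 'b::real_normed_vector) \<Rightarrow> ennreal" where
  "sup_norm f = (SUP x. ennreal (norm (f x)))"

(* For m < 0 the terms with j < -m vanish, since rGamma is 0 at the nonpositive integers;
   in particular no negative power of x contributes. *)
definition bessel_J :: "int \<Rightarrow> real \<Rightarrow> real" where
  "bessel_J m x =
     (\<Sum>j. (-1) ^ j * rGamma (of_int (m + int j + 1)) / fact j * (x / 2) powi (2 * int j + m))"

(* The n-th positive zero, counted from n = 1: the positive zero with exactly n zeros in (0, z]. *)
definition bessel_zero :: "int \<Rightarrow> nat \<Rightarrow> real" where
  "bessel_zero m n =
     (THE z. 0 < z \<and> bessel_J m z = 0 \<and> card {x. 0 < x \<and> x \<le> z \<and> bessel_J m x = 0} = n)"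

definition K_order :: "int \<Rightarrow> nat \<Rightarrow> int" where
  "K_order m n = \<lceil>bessel_zero m n / pi\<rceil>"

definition K_max :: "nat \<Rightarrow> nat \<Rightarrow> int" where
  "K_max M N = Max ((\<lambda>(m, n). K_order m n) ` ({0..int M} \<times> {1..N}))"

(* Arg takes values in (-pi, pi] and Arg 0 = 0, so this is atan2. *)
definition polar_angle :: "real \<times> real \<Rightarrow> real" where
  "polar_angle x = Arg (Complex (fst x) (snd x))"

definition Psi_polar :: "int \<Rightarrow> nat \<Rightarrow> real \<Rightarrow> real \<Rightarrow> complex" where
  "Psi_polar m n r \<theta> =
     (if r \<le> 1
      then cis (of_int m * \<theta>) * of_real (bessel_J m (bessel_zero m n * r))
             / of_real (sqrt pi * \<bar>bessel_J (m + 1) (bessel_zero m n)\<bar>)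
      else 0)"

definition Psi :: "int \<Rightarrow> nat \<Rightarrow> real \<times> real \<Rightarrow> complex" where
  "Psi m n x = Psi_polar m n (norm x) (polar_angle x)"

definition FB_coeff :: "(real \<times> real \<Rightarrow> complex) \<Rightarrow> int \<Rightarrow> nat \<Rightarrow> complex" where
  "FB_coeff f m n =
     integral {0..2 * pi} (\<lambda>\<theta>. integral {0..1} (\<lambda>r.
       f (r * cos \<theta>, r * sin \<theta>) * cnj (Psi_polar m n r \<theta>) * of_real r))"

definition FB_sum :: "nat \<Rightarrow> nat \<Rightarrow> (real \<times> real \<Rightarrow> complex) \<Rightarrow> real \<times> real \<Rightarrow> complex" where
  "FB_sum M N f x = (\<Sum>m = - int M..int M. \<Sum>n = 1..N. FB_coeff f m n * Psi m n x)"

definition grid_point :: "nat \<Rightarrow> nat \<Rightarrow> real" where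
  "grid_point L i = -1 + (real i - 1) * (2 / real L)"

definition finite_fourier :: "(real \<times> real \<Rightarrow> complex) \<Rightarrow> nat \<Rightarrow> int \<times> int \<Rightarrow> complex" where
  "finite_fourier f L k =
     of_real ((2 / real L)\<^sup>2) * (\<Sum>i = 1..L. \<Sum>j = 1..L.
       f (grid_point L i, grid_point L j) *
       exp (- (of_real pi * \<i> *
         of_real (of_int (fst k) * grid_point L i + of_int (snd k) * grid_point L j))))"

definition freq_vec :: "int \<times> int \<Rightarrow> real \<times> real" where
  "freq_vec k = (of_int (fst k), of_int (snd k))"

definition epsilon :: "int \<Rightarrow> real" where
  "epsilon m = (if m \<ge> 0 then 1 else (-1) powi m)"

(* J_m(rho) / (rho^2 - z^2) at z = z_{m,n}, continued by its limit at rho = z. *)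
definition bessel_quotient :: "int \<Rightarrow> nat \<Rightarrow> real \<Rightarrow> real" where
  "bessel_quotient m n \<rho> =
     (let z = bessel_zero m n in
      if \<rho> = z then deriv (bessel_J m) z / (2 * z)
      else bessel_J m \<rho> / (\<rho>\<^sup>2 - z\<^sup>2))"

definition FFB_weight :: "int \<times> int \<Rightarrow> int \<Rightarrow> nat \<Rightarrow> complex" where
  "FFB_weight k m n =
     of_real (epsilon m * sqrt pi * (-1) ^ n) * \<i> powi m * of_real (bessel_zero m n) *
     (of_real (bessel_quotient m n (pi * norm (freq_vec k))) *
      cis (- of_int m * polar_angle (freq_vec k)) / 2)"

definition FFB_coeff :: "nat \<Rightarrow> (real \<times> real \<Rightarrow> complex) \<Rightarrow> int \<Rightarrow> nat \<Rightarrow> complex" where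
  "FFB_coeff K f m n =
     (\<Sum>k\<in>{- int K..int K} \<times> {- int K..int K}.
        FFB_weight k m n * finite_fourier f (2 * K + 1) k)"

definition FFB_sum ::
    "nat \<Rightarrow> nat \<Rightarrow> nat \<Rightarrow> (real \<times> real \<Rightarrow> complex) \<Rightarrow> real \<times> real \<Rightarrow> complex" where
  "FFB_sum K M N f x = (\<Sum>m = - int M..int M. \<Sum>n = 1..N. FFB_coeff K f m n * Psi m n x)"

end

theory Submission
  imports Defs
begin

text \<open>The weight of \<open>k\<close> is a quarter of the Fourier-Bessel coefficient of the wave \<open>e\<^sub>k\<close>, so the finite
  transform of order \<open>K\<close> agrees with \<open>C\<^sub>m\<^sub>,\<^sub>n\<close> on trigonometric polynomials of degree at most \<open>K\<close>.
  As the weights are square summable, the discrete Parseval identity and the Cauchy-Schwarz inequality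
  bound the finite transform by the sup norm, uniformly in \<open>K\<close>. Hence the error at \<open>f\<close> is at most a
  constant times the uniform distance from \<open>f\<close> to the trigonometric polynomials of degree \<open>K\<close>.
  That distance is \<open>O(1/K)\<close> by Jackson's argument: \<open>f\<close> vanishes on the boundary of the square, so it is
  Lipschitz on the torus, and its discrete convolution with the Fejer-Korovkin kernel on the sampling
  grid itself is the approximant, with all kernel moments given by discrete Parseval.\<close>

section \<open>Integral representation and recurrences of Bessel functions\<close>

lemma integral_suminf_Weierstrass:
  fixes f :: "nat \<Rightarrow> real \<Rightarrow> complex"
  assumes cont: "\<And>n. continuous_on {a..b} (f n)"
    and bound: "\<And>n t. t \<in> {a..b} \<Longrightarrow> norm (f n t) \<le> B n"
    and "summable B"
  shows "(\<lambda>n. integral {a..b} (f n)) sums integral {a..b} (\<lambda>t. \<Sum>n. f n t)"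
proof -
  have u: "uniform_limit {a..b} (\<lambda>n t. \<Sum>i<n. f i t) (\<lambda>t. \<Sum>i. f i t) sequentially"
    using bound \<open>summable B\<close> by (intro Weierstrass_m_test) auto
  obtain I J where I: "\<And>n. ((\<lambda>t. \<Sum>i<n. f i t) has_integral I n) {a..b}"
    and J: "((\<lambda>t. \<Sum>i. f i t) has_integral J) {a..b}" and lim: "I \<longlonglongrightarrow> J"
    by (rule uniform_limit_integral[OF u]) (auto intro!: continuous_intros cont)
  have "I n = (\<Sum>i<n. integral {a..b} (f i))" for n
    using integral_unique[OF I[of n]] integrable_continuous_real[OF cont]
    by (simp add: integral_sum)
  then have "I = (\<lambda>n. \<Sum>i<n. integral {a..b} (f i))" by auto
  with lim integral_unique[OF J] show ?thesis
    unfolding sums_def by simp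
qed

lemma integral_cis_of_int:
  "integral {0..2 * pi} (\<lambda>t. cis (of_int k * t)) = (if k = 0 then of_real (2 * pi) else 0)"
proof (cases "k = 0")
  case True
  then show ?thesis by (simp add: scaleR_conv_of_real)
next
  case False
  have "((\<lambda>t. cis (of_int k * t) / (\<i> * of_int k)) has_vector_derivative cis (of_int k * t)) (at t within {0..2*pi})"
    for t
    using False unfolding cis_conv_exp
    by (auto intro!: derivative_eq_intros has_vector_derivative_real_field simp: field_simps)
  then have "((\<lambda>t. cis (of_int k * t)) has_integral
      (cis (of_int k * (2 * pi)) / (\<i> * of_int k) - cis (of_int k * 0) / (\<i> * of_int k))) {0..2 * pi}"
    by (intro fundamental_theorem_of_calculus) auto
  moreover have "cis (of_int k * (2 * pi)) = 1"
    by (metis cis_multiple_2pi mult.commute Ints_of_int)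
  ultimately show ?thesis using False by (auto dest: integral_unique)
qed

lemma exp_sums_divide: "(\<lambda>n. z ^ n / fact n) sums exp (z :: complex)"
  using exp_converges[of z] by (simp add: scaleR_conv_of_real field_simps)

lemma integral_exp_cis:
  fixes A :: complex
  shows "integral {0..2 * pi} (\<lambda>t. exp (A * cis t) * cis (- of_int p * t)) =
    of_real (2 * pi) * (if p \<ge> 0 then A ^ nat p / fact (nat p) else 0)"
proof -
  let ?f = "\<lambda>n t. (A ^ n / fact n) * cis (of_int (int n - p) * t)"
  have pt: "(\<Sum>n. ?f n t) = exp (A * cis t) * cis (- of_int p * t)" for t
  proof -
    have "(\<lambda>n. (A * cis t) ^ n / fact n * cis (- of_int p * t)) sums (exp (A * cis t) * cis (- of_int p * t))"
      by (intro sums_mult2 exp_sums_divide)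
    moreover have "(A * cis t) ^ n / fact n * cis (- of_int p * t) = ?f n t" for n
      by (simp add: power_mult_distrib Complex.DeMoivre cis_mult algebra_simps)
    ultimately show ?thesis by (simp add: sums_iff)
  qed
  have "summable (\<lambda>n. norm A ^ n / fact n)"
    using summable_exp[of "norm A"] by (simp add: field_simps)
  then have "(\<lambda>n. integral {0..2*pi} (?f n)) sums integral {0..2*pi} (\<lambda>t. \<Sum>n. ?f n t)"
    by (intro integral_suminf_Weierstrass[where B = "\<lambda>n. norm A ^ n / fact n"])
       (auto intro!: continuous_intros simp: norm_mult norm_divide norm_power)
  then have "(\<lambda>n. A ^ n / fact n * (if int n = p then of_real (2*pi) else 0)) sums
      integral {0..2*pi} (\<lambda>t. exp (A * cis t) * cis (- of_int p * t))"
    unfolding pt by (subst (asm) integral_mult_right) (simp only: integral_cis_of_int, simp)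
  moreover have "(\<lambda>n. A ^ n / fact n * (if int n = p then of_real (2*pi) else 0)) sums
      (of_real (2 * pi) * (if p \<ge> 0 then A ^ nat p / fact (nat p) else 0))"
  proof (cases "p \<ge> 0")
    case True
    then have "(\<lambda>n. A ^ n / fact n * (if int n = p then of_real (2*pi) else 0)) =
        (\<lambda>n. if n = nat p then A ^ nat p / fact (nat p) * of_real (2*pi) else 0)"
      by (intro ext) auto
    then show ?thesis using True sums_single[of "nat p" "\<lambda>_. A ^ nat p / fact (nat p) * complex_of_real (2*pi)"]
      by (simp add: mult.commute)
  next
    case False
    then have "\<And>n. int n \<noteq> p" by auto
    with False show ?thesis by simp
  qed
  ultimately show ?thesis by (rule sums_unique2)
qed

text \<open>Splitting \<open>exp (\<i> x cos (t - \<Phi>))\<close> into the exponentials of \<open>A e\<^sup>i\<^sup>t\<close> and \<open>B e\<^sup>-\<^sup>i\<^sup>t\<close> and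
  expanding only the latter produces the defining series of \<open>J\<^sub>m\<close> for every sign of \<open>m\<close> at once,
  and the phase \<open>\<Phi>\<close> comes out without a change of variables.\<close>

lemma bessel_integral:
  "integral {0..2 * pi} (\<lambda>t. cis (x * cos (t - \<Phi>)) * cis (- of_int m * t)) =
     of_real (2 * pi) * \<i> powi m * cis (- of_int m * \<Phi>) * of_real (bessel_J m x)"
proof -
  define A where "A = \<i> * of_real (x / 2) * cis (- \<Phi>)"
  define B where "B = \<i> * of_real (x / 2) * cis \<Phi>"
  let ?f = "\<lambda>n t. (B ^ n / fact n) * (exp (A * cis t) * cis (- of_int (m + int n) * t))"
  have pt: "(\<Sum>n. ?f n t) = cis (x * cos (t - \<Phi>)) * cis (- of_int m * t)" for t
  proof -
    have s: "(\<lambda>n. (B * cis (- t)) ^ n / fact n * (exp (A * cis t) * cis (- of_int m * t))) sums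
       (exp (B * cis (- t)) * (exp (A * cis t) * cis (- of_int m * t)))"
      by (intro sums_mult2 exp_sums_divide)
    moreover have e: "(B * cis (- t)) ^ n / fact n * (exp (A * cis t) * cis (- of_int m * t)) = ?f n t" for n
      by (simp add: power_mult_distrib Complex.DeMoivre cis_mult algebra_simps)
    moreover have ex: "exp (B * cis (- t)) * exp (A * cis t) = cis (x * cos (t - \<Phi>))"
    proof -
      have "B * cis (- t) + A * cis t = \<i> * of_real (x / 2) * (cis (t - \<Phi>) + cis (- (t - \<Phi>)))"
        unfolding A_def B_def by (simp add: mult.assoc cis_mult) (simp add: algebra_simps)
      also have "cis (t - \<Phi>) + cis (- (t - \<Phi>)) = of_real (2 * cos (t - \<Phi>))"
        by (simp add: complex_eq_iff del: minus_diff_eq)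
      finally show ?thesis by (simp add: exp_add[symmetric] cis_conv_exp)
    qed
    ultimately have "(\<lambda>n. ?f n t) sums (exp (B * cis (- t)) * (exp (A * cis t) * cis (- of_int m * t)))"
      by (simp only:)
    then show ?thesis unfolding mult.assoc[symmetric] ex by (simp add: sums_iff)
  qed
  define E where "E = exp (norm A)"
  have E: "norm (exp (A * cis t)) \<le> E" for t
    using norm_exp[of "A * cis t"] by (simp add: E_def norm_mult)
  have "summable (\<lambda>n. norm B ^ n / fact n * E)"
    using summable_mult2[OF summable_exp[of "norm B"], of E] by (simp add: field_simps)
  then have "(\<lambda>n. integral {0..2*pi} (?f n)) sums integral {0..2*pi} (\<lambda>t. \<Sum>n. ?f n t)"
    using E
    by (intro integral_suminf_Weierstrass[where B = "\<lambda>n. norm B ^ n / fact n * E"])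
       (auto intro!: continuous_intros mult_left_mono divide_right_mono simp: norm_mult norm_divide norm_power)
  then have "(\<lambda>n. B ^ n / fact n * (of_real (2 * pi) * (if m + int n \<ge> 0 then A ^ nat (m + int n) / fact (nat (m + int n)) else 0)))
      sums integral {0..2*pi} (\<lambda>t. cis (x * cos (t - \<Phi>)) * cis (- of_int m * t))"
    unfolding pt by (subst (asm) integral_mult_right) (simp only: integral_exp_cis)
  moreover have "B ^ n / fact n * (of_real (2 * pi) * (if m + int n \<ge> 0 then A ^ nat (m + int n) / fact (nat (m + int n)) else 0))
     = of_real (2 * pi) * \<i> powi m * cis (- of_int m * \<Phi>) *
       of_real ((-1) ^ n * rGamma (of_int (m + int n + 1)) / fact n * (x / 2) powi (2 * int n + m))"
    for n
  proof (cases "m + int n \<ge> 0")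
    case False
    then show ?thesis by (simp add: rGamma_of_int del: of_int_add)
  next
    case True
    define q where "q = nat (m + int n)"
    have m: "m = int q - int n" using True by (simp add: q_def)
    have "A ^ q * B ^ n = \<i> ^ (q + n) * of_real (x / 2) ^ (q + n) * cis (- of_int m * \<Phi>)"
    proof -
      have q: "A ^ q = \<i> ^ q * of_real (x / 2) ^ q * cis (real q * - \<Phi>)"
        and n: "B ^ n = \<i> ^ n * of_real (x / 2) ^ n * cis (real n * \<Phi>)"
        by (simp_all only: A_def B_def power_mult_distrib Complex.DeMoivre)
      have "A ^ q * B ^ n = \<i> ^ (q + n) * of_real (x / 2) ^ (q + n) * (cis (real q * - \<Phi>) * cis (real n * \<Phi>))"
        unfolding q n power_add by (simp only: mult_ac)
      also have "cis (real q * - \<Phi>) * cis (real n * \<Phi>) = cis (- of_int m * \<Phi>)"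
        unfolding cis_mult by (rule arg_cong[of _ _ cis]) (simp add: m algebra_simps)
      finally show ?thesis .
    qed
    moreover have "\<i> ^ (q + n) = \<i> powi m * (-1) ^ n"
    proof -
      have "\<i> ^ (q + n) = \<i> powi (m + int (2 * n))"
        unfolding power_int_of_nat[symmetric] by (rule arg_cong[of _ _ "\<lambda>k. \<i> powi k"]) (simp add: m)
      also have "\<dots> = \<i> powi m * (\<i> ^ 2) ^ n"
        by (subst power_int_add) (simp_all add: power_mult power_int_of_nat del: of_nat_mult)
      finally show ?thesis by simp
    qed
    moreover have "(x / 2) powi (2 * int n + m) = (x / 2) ^ (q + n)"
    proof -
      have "2 * int n + m = int (q + n)" by (simp add: m)
      then show ?thesis by (simp only: power_int_of_nat)
    qed
    moreover have "rGamma (of_int (m + int n + 1)) = 1 / (fact q :: real)"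
      using True by (simp add: rGamma_of_int q_def divide_inverse del: of_int_add)
    moreover have "B ^ n / fact n * (of_real (2 * pi) * (A ^ q / fact q)) = of_real (2 * pi) * (A ^ q * B ^ n) / (fact n * fact q)"
      by simp
    ultimately show ?thesis using True
      by (simp only: q_def[symmetric] if_True) (simp add: mult_ac)
  qed
  ultimately have S: "(\<lambda>n. of_real (2 * pi) * \<i> powi m * cis (- of_int m * \<Phi>) *
       of_real ((-1) ^ n * rGamma (of_int (m + int n + 1)) / fact n * (x / 2) powi (2 * int n + m)))
      sums integral {0..2*pi} (\<lambda>t. cis (x * cos (t - \<Phi>)) * cis (- of_int m * t))"
    by (simp only:)
  define c where "c = of_real (2 * pi) * \<i> powi m * cis (- of_int m * \<Phi>)"
  have c: "c \<noteq> 0" by (simp add: c_def)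
  define a where "a n = (-1) ^ n * rGamma (of_int (m + int n + 1)) / fact n * (x / 2) powi (2 * int n + m)" for n
  have "(\<lambda>n. complex_of_real (a n)) sums (integral {0..2*pi} (\<lambda>t. cis (x * cos (t - \<Phi>)) * cis (- of_int m * t)) / c)"
    using sums_divide[OF S, of c] c unfolding c_def[symmetric] a_def[symmetric] by simp
  moreover from this have "summable a"
    using summable_Re sums_summable by fastforce
  then have "(\<lambda>n. complex_of_real (a n)) sums complex_of_real (\<Sum>n. a n)"
    by (simp add: sums_of_real summable_sums)
  ultimately have "integral {0..2*pi} (\<lambda>t. cis (x * cos (t - \<Phi>)) * cis (- of_int m * t)) / c = complex_of_real (\<Sum>n. a n)"
    by (rule sums_unique2)
  then show ?thesis using c by (simp add: bessel_J_def a_def[abs_def] c_def field_simps)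
qed

lemma bessel_integral_0:
  "integral {0..2 * pi} (\<lambda>t. cis (x * cos t) * cis (- of_int m * t)) =
     of_real (2 * pi) * \<i> powi m * of_real (bessel_J m x)"
  using bessel_integral[of x 0 m] by simp

lemma norm_i_powi [simp]: "norm (\<i> powi m) = 1"
  by (simp add: norm_power_int)

lemma abs_bessel_J_le: "\<bar>bessel_J m x\<bar> \<le> 1"
proof -
  have "norm (integral {0..2 * pi} (\<lambda>t. cis (x * cos t) * cis (- of_int m * t))) \<le> 1 * (2 * pi - 0)"
    by (rule integral_bound) (auto intro!: continuous_intros simp: norm_mult)
  then show ?thesis
    unfolding bessel_integral_0 by (simp add: norm_mult)
qed

lemma bessel_J_uminus: "bessel_J (- m) x = (-1) powi m * bessel_J m x"
proof -
  have "cnj (integral {0..2 * pi} (\<lambda>t. cis (x * cos t) * cis (- of_int m * t))) =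
        integral {0..2 * pi} (\<lambda>t. cnj (cis (x * cos t) * cis (- of_int m * t)))"
    by (rule integral_cnj)
  also have "\<dots> = integral {0..2 * pi} (\<lambda>t. cis (x * cos (t - pi)) * cis (- of_int (- m) * t))"
    by (simp add: cis_cnj)
  finally have "cnj (\<i> powi m) * of_real (bessel_J m x) = \<i> powi (- m) * cis (of_int m * pi) * of_real (bessel_J (- m) x)"
    unfolding bessel_integral bessel_integral_0 by simp
  moreover have "cnj (\<i> powi m) = \<i> powi (- m)"
    by (simp add: power_int_def)
  moreover have "cis (of_int m * pi) = of_real ((-1) powi m)"
    using cis_power_int[of pi m] by simp
  ultimately have "of_real (bessel_J m x) = (of_real ((-1) powi m * bessel_J (- m) x) :: complex)"
    by simp
  then have "bessel_J m x = (-1) powi m * bessel_J (- m) x"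
    unfolding of_real_eq_iff .
  moreover have "(-1) powi m * (-1) powi m = (1 :: real)"
    by (simp add: power_int_mult_distrib[symmetric])
  ultimately show ?thesis by simp
qed

lemma has_real_derivative_bessel_J:
  "(bessel_J m has_real_derivative (bessel_J (m - 1) x - bessel_J (m + 1) x) / 2) (at x)"
proof -
  define c where "c = of_real (2 * pi) * \<i> powi m"
  have c: "c \<noteq> 0" by (simp add: c_def)
  let ?f = "\<lambda>x t. cis (x * cos t) * cis (- of_int m * t)"
  let ?f' = "\<lambda>x t. \<i> * of_real (cos t) * ?f x t"
  have "((\<lambda>x. integral (cbox 0 (2 * pi)) (?f x)) has_vector_derivative integral (cbox 0 (2 * pi)) (?f' x)) (at x within UNIV)"
  proof (rule leibniz_rule_vector_derivative)
    show "((\<lambda>x. ?f x t) has_vector_derivative ?f' x t) (at x within UNIV)" for x t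
      unfolding cis_conv_exp
      by (auto intro!: derivative_eq_intros has_vector_derivative_real_field)
  qed (auto intro!: continuous_intros integrable_continuous_real simp: case_prod_unfold)
  then have G: "((\<lambda>x. c * of_real (bessel_J m x)) has_vector_derivative integral {0..2*pi} (?f' x)) (at x)"
    unfolding cbox_interval bessel_integral_0 c_def by simp
  have "integral {0..2*pi} (?f' x) =
     integral {0..2*pi} (\<lambda>t. \<i> / 2 * (cis (x * cos t) * cis (- of_int (m - 1) * t) + cis (x * cos t) * cis (- of_int (m + 1) * t)))"
  proof (rule integral_cong)
    fix t :: real
    have e: "cis t + cis (- t) = of_real (2 * cos t)" by (simp add: complex_eq_iff)
    have "?f' x t = \<i> / 2 * (cis t + cis (- t)) * ?f x t" unfolding e by simp
    also have "\<dots> = \<i> / 2 * (cis (x * cos t) * (cis t * cis (- of_int m * t)) + cis (x * cos t) * (cis (- t) * cis (- of_int m * t)))"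
      by (simp add: algebra_simps)
    finally show "?f' x t = \<i> / 2 * (cis (x * cos t) * cis (- of_int (m - 1) * t) + cis (x * cos t) * cis (- of_int (m + 1) * t))"
      by (simp add: cis_mult algebra_simps)
  qed
  also have "\<dots> = \<i> / 2 * (integral {0..2*pi} (\<lambda>t. cis (x * cos t) * cis (- of_int (m - 1) * t)) +
      integral {0..2*pi} (\<lambda>t. cis (x * cos t) * cis (- of_int (m + 1) * t)))"
    by (subst integral_mult_right, subst integral_add)
       (auto intro!: continuous_intros integrable_continuous_real)
  also have "\<dots> = c * of_real ((bessel_J (m - 1) x - bessel_J (m + 1) x) / 2)"
    unfolding bessel_integral_0 by (simp add: c_def power_int_add power_int_diff field_simps)
  finally have "((\<lambda>x. c * of_real (bessel_J m x)) has_vector_derivative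
      c * of_real ((bessel_J (m - 1) x - bessel_J (m + 1) x) / 2)) (at x)"
    using G by (simp only:)
  from has_vector_derivative_mult_right[OF this, of "1 / c"]
  have "((\<lambda>x. of_real (bessel_J m x) :: complex) has_vector_derivative
      of_real ((bessel_J (m - 1) x - bessel_J (m + 1) x) / 2)) (at x)"
    using c by simp
  from bounded_linear.has_vector_derivative[OF bounded_linear_Re this]
  show ?thesis
    by (simp add: has_real_derivative_iff_has_vector_derivative)
qed

lemma bessel_J_recurrence:
  "x * (bessel_J (m - 1) x + bessel_J (m + 1) x) = 2 * of_int m * bessel_J m x"
proof -
  let ?f = "\<lambda>t. cis (x * cos t) * cis (- of_int m * t)"
  have "((\<lambda>t. (- \<i> * of_real (x * sin t) - \<i> * of_int m) * ?f t) has_integral (?f (2 * pi) - ?f 0)) {0..2 * pi}"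
  proof (intro fundamental_theorem_of_calculus)
    show "(?f has_vector_derivative (- \<i> * of_real (x * sin t) - \<i> * of_int m) * ?f t) (at t within {0..2*pi})" for t
    proof -
      have "((\<lambda>t. cis (x * cos t)) has_vector_derivative (x * - sin t) *\<^sub>R (\<i> * cis (x * cos t))) (at t within {0..2*pi})"
        unfolding has_vector_derivative_def
        by (auto intro!: derivative_eq_intros ext simp: scaleR_conv_of_real)
      moreover have "((\<lambda>t. cis (- of_int m * t)) has_vector_derivative (- of_int m) *\<^sub>R (\<i> * cis (- of_int m * t))) (at t within {0..2*pi})"
        unfolding has_vector_derivative_def
        by (auto intro!: derivative_eq_intros ext simp: scaleR_conv_of_real)
      ultimately show ?thesis
        by (auto intro!: derivative_eq_intros simp: scaleR_conv_of_real algebra_simps)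
    qed
  qed auto
  moreover have "cis (- of_int m * (2 * pi)) = 1"
    using cis_multiple_2pi[of "- of_int m"] by (simp add: mult.commute)
  ultimately have "integral {0..2*pi} (\<lambda>t. (- \<i> * of_real (x * sin t) - \<i> * of_int m) * ?f t) = 0"
    by (auto dest!: integral_unique)
  also have "(\<lambda>t. (- \<i> * of_real (x * sin t) - \<i> * of_int m) * ?f t) =
     (\<lambda>t. - of_real (x / 2) * (cis (x * cos t) * cis (- of_int (m - 1) * t)) +
        (of_real (x / 2) * (cis (x * cos t) * cis (- of_int (m + 1) * t)) - \<i> * of_int m * ?f t))"
  proof
    fix t :: real
    have "2 * \<i> * of_real (sin t) = cis t - cis (- t)" by (simp add: complex_eq_iff)
    moreover have "- \<i> * of_real (x * sin t) = - of_real (x / 2) * (2 * \<i> * of_real (sin t))"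
      by simp
    ultimately have "(- \<i> * of_real (x * sin t) - \<i> * of_int m) * ?f t =
        (- of_real (x / 2) * (cis t - cis (- t)) - \<i> * of_int m) * ?f t" 
      by simp
    also have "\<dots> = - of_real (x / 2) * (cis (x * cos t) * (cis t * cis (- of_int m * t))) +
        (of_real (x / 2) * (cis (x * cos t) * (cis (- t) * cis (- of_int m * t))) - \<i> * of_int m * ?f t)"
      by (simp add: field_simps)
    finally show "(- \<i> * of_real (x * sin t) - \<i> * of_int m) * ?f t = - of_real (x / 2) * (cis (x * cos t) * cis (- of_int (m - 1) * t)) +
        (of_real (x / 2) * (cis (x * cos t) * cis (- of_int (m + 1) * t)) - \<i> * of_int m * ?f t)"
      by (simp add: cis_mult algebra_simps)
  qed
  also have "integral {0..2*pi} \<dots> = 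
    - of_real (x / 2) * integral {0..2*pi} (\<lambda>t. cis (x * cos t) * cis (- of_int (m - 1) * t)) +
    (of_real (x / 2) * integral {0..2*pi} (\<lambda>t. cis (x * cos t) * cis (- of_int (m + 1) * t)) -
     \<i> * of_int m * integral {0..2*pi} ?f)"
    by (simp only: integral_add integral_diff integral_mult_right integrable_continuous_real continuous_intros)
  also have "\<dots> = of_real (2 * pi) * \<i> powi m * \<i> * of_real (x * (bessel_J (m - 1) x + bessel_J (m + 1) x) - 2 * of_int m * bessel_J m x) / 2"
    unfolding bessel_integral_0 by (simp add: power_int_add power_int_diff field_simps)
  finally have "complex_of_real (x * (bessel_J (m - 1) x + bessel_J (m + 1) x) - 2 * of_int m * bessel_J m x) = 0"
    by (simp del: of_real_diff of_real_mult of_real_add)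
  then show ?thesis unfolding of_real_eq_0_iff by simp
qed

definition bessel_J' :: "int \<Rightarrow> real \<Rightarrow> real" where
  "bessel_J' m x = (bessel_J (m - 1) x - bessel_J (m + 1) x) / 2"

lemma bessel_J_derivative [derivative_intros]:
  assumes "(g has_real_derivative g') (at x within S)"
  shows "((\<lambda>x. bessel_J m (g x)) has_real_derivative bessel_J' m (g x) * g') (at x within S)"
  using DERIV_chain2[OF has_real_derivative_bessel_J assms] by (simp add: bessel_J'_def)

lemma deriv_bessel_J: "deriv (bessel_J m) x = bessel_J' m x"
  unfolding bessel_J'_def by (rule DERIV_imp_deriv[OF has_real_derivative_bessel_J])

lemma continuous_on_bessel_J [continuous_intros]:
  "continuous_on S g \<Longrightarrow> continuous_on S (\<lambda>x. bessel_J m (g x))"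
  using DERIV_continuous_on[OF has_field_derivative_at_within[OF has_real_derivative_bessel_J], of UNIV m]
  by (rule continuous_on_compose2) auto

lemma bessel_J'_eq_Suc: "x * bessel_J' m x = of_int m * bessel_J m x - x * bessel_J (m + 1) x"
  using bessel_J_recurrence[of x m] by (simp add: bessel_J'_def field_simps)

lemma bessel_J'_eq_pred: "x * bessel_J' m x = x * bessel_J (m - 1) x - of_int m * bessel_J m x"
  using bessel_J_recurrence[of x m] by (simp add: bessel_J'_def field_simps)

lemma bessel_ode:
  "((\<lambda>x. x * bessel_J' m x) has_real_derivative y) (at x)" 
  if "x * y = (of_int m ^ 2 - x\<^sup>2) * bessel_J m x" "x \<noteq> 0"
proof -
  have "((\<lambda>x. of_int m * bessel_J m x - x * bessel_J (m + 1) x) has_real_derivative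
     (of_int m * bessel_J' m x - (bessel_J (m + 1) x + x * bessel_J' (m + 1) x))) (at x)"
    by (auto intro!: derivative_eq_intros)
  moreover have "of_int m * bessel_J' m x - (bessel_J (m + 1) x + x * bessel_J' (m + 1) x) = y"
  proof -
    have "x * (of_int m * bessel_J' m x - (bessel_J (m + 1) x + x * bessel_J' (m + 1) x)) =
      of_int m * (x * bessel_J' m x) - x * (bessel_J (m + 1) x + x * bessel_J' (m + 1) x)"
      by (simp add: algebra_simps)
    also have "\<dots> = x * y"
      unfolding that(1) bessel_J'_eq_Suc[of x m] bessel_J'_eq_pred[of x "m+1"]
      by (simp add: algebra_simps power2_eq_square)
    finally show ?thesis using that(2) by simp
  qed
  ultimately show ?thesis unfolding bessel_J'_eq_Suc by simp
qed

lemma bessel_J_at_0: "bessel_J m 0 = (if m = 0 then 1 else 0)"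
proof -
  have "integral {0..2 * pi} (\<lambda>t. cis (of_int (- m) * t)) = of_real (2 * pi) * \<i> powi m * of_real (bessel_J m 0)"
    using bessel_integral_0[of 0 m] by simp
  then show ?thesis unfolding integral_cis_of_int by (auto split: if_splits)
qed

lemma DERIV_bessel_J: "(bessel_J m has_real_derivative bessel_J' m x) (at x)"
  using bessel_J_derivative[of "\<lambda>x. x" 1 x] by simp

lemma bessel_ode_scaled:
  assumes "r \<noteq> 0"
  shows "((\<lambda>r. c * r * bessel_J' m (c * r)) has_real_derivative
    (of_int m ^ 2 - (c * r)\<^sup>2) / r * bessel_J m (c * r)) (at r)"
proof (cases "c = 0")
  case True
  then show ?thesis by (simp add: bessel_J_at_0)
next
  case False
  define y where "y = (of_int m ^ 2 - (c * r)\<^sup>2) / (c * r) * bessel_J m (c * r)"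
  have "((\<lambda>x. x * bessel_J' m x) has_real_derivative y) (at (c * r))"
    using assms False by (intro bessel_ode) (simp_all add: y_def)
  moreover have "((\<lambda>r. c * r) has_real_derivative c) (at r)"
    by (auto intro!: derivative_eq_intros)
  ultimately have "((\<lambda>r. c * r * bessel_J' m (c * r)) has_real_derivative y * c) (at r)"
    by (rule DERIV_chain2)
  then show ?thesis using False assms by (simp add: y_def)
qed

lemma continuous_on_bessel_J' [continuous_intros]:
  "continuous_on S g \<Longrightarrow> continuous_on S (\<lambda>x. bessel_J' m (g x))"
  unfolding bessel_J'_def by (intro continuous_intros) auto

lemma lommel_integral:
  assumes "bessel_J m z = 0"
  shows "((\<lambda>r. (a\<^sup>2 - z\<^sup>2) * (bessel_J m (a * r) * bessel_J m (z * r) * r)) has_integral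
    z * bessel_J m a * bessel_J' m z) {0..1}"
proof -
  define W where "W r = bessel_J m (a * r) * (z * r * bessel_J' m (z * r)) -
    bessel_J m (z * r) * (a * r * bessel_J' m (a * r))" for r
  have "((\<lambda>r. (a\<^sup>2 - z\<^sup>2) * (bessel_J m (a * r) * bessel_J m (z * r) * r)) has_integral (W 1 - W 0)) {0..1}"
  proof (rule fundamental_theorem_of_calculus_interior)
    show "continuous_on {0..1} W"
      unfolding W_def by (intro continuous_intros)
    fix r :: real assume "r \<in> {0<..<1}"
    then have "r \<noteq> 0" by auto
    have "(W has_real_derivative (a\<^sup>2 - z\<^sup>2) * (bessel_J m (a * r) * bessel_J m (z * r) * r)) (at r)"
      unfolding W_def
      by (rule derivative_eq_intros bessel_ode_scaled \<open>r \<noteq> 0\<close> refl)+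
         (use \<open>r \<noteq> 0\<close> in \<open>simp add: field_simps power2_eq_square\<close>)
    then show "(W has_vector_derivative (a\<^sup>2 - z\<^sup>2) * (bessel_J m (a * r) * bessel_J m (z * r) * r)) (at r)"
      by (simp add: has_real_derivative_iff_has_vector_derivative)
  qed auto
  then show ?thesis using assms by (simp add: W_def mult_ac)
qed

lemma lommel_integral_square:
  assumes "bessel_J m z = 0"
  shows "((\<lambda>r. 2 * z\<^sup>2 * (bessel_J m (z * r) * bessel_J m (z * r) * r)) has_integral
    (z * bessel_J' m z)\<^sup>2) {0..1}"
proof -
  define W where "W r = (z * r * bessel_J' m (z * r))\<^sup>2 +
    ((z * r)\<^sup>2 - of_int m ^ 2) * (bessel_J m (z * r))\<^sup>2" for r
  have "((\<lambda>r. 2 * z\<^sup>2 * (bessel_J m (z * r) * bessel_J m (z * r) * r)) has_integral (W 1 - W 0)) {0..1}"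
  proof (rule fundamental_theorem_of_calculus_interior)
    show "continuous_on {0..1} W"
      unfolding W_def by (intro continuous_intros)
    fix r :: real assume "r \<in> {0<..<1}"
    then have "r \<noteq> 0" by auto
    have "(W has_real_derivative 2 * z\<^sup>2 * (bessel_J m (z * r) * bessel_J m (z * r) * r)) (at r)"
      unfolding W_def
      by (rule derivative_eq_intros bessel_ode_scaled \<open>r \<noteq> 0\<close> refl)+
         (use \<open>r \<noteq> 0\<close> in \<open>simp add: field_simps power2_eq_square\<close>)
    then show "(W has_vector_derivative 2 * z\<^sup>2 * (bessel_J m (z * r) * bessel_J m (z * r) * r)) (at r)"
      by (simp add: has_real_derivative_iff_has_vector_derivative)
  qed auto
  then show ?thesis using assms by (cases "m = 0") (simp_all add: W_def bessel_J_at_0)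
qed

section \<open>Zeros of Bessel functions\<close>

lemma bessel_J_pos_near_0:
  "\<exists>e>0. \<forall>(m::nat) x. 0 < x \<longrightarrow> x < e \<longrightarrow> bessel_J (int m) x > 0"
proof -
  have "continuous_on UNIV (bessel_J 0)"
    using continuous_on_bessel_J[OF continuous_on_id] by simp
  then have "isCont (bessel_J 0) 0"
    by (simp add: continuous_on_eq_continuous_at)
  then have "\<forall>\<^sub>F x in at 0. bessel_J 0 x > 0"
    by (auto simp: continuous_at bessel_J_at_0 dest!: order_tendstoD(1)[where a = 0])
  then obtain e where e: "e > 0" "\<And>x. x \<noteq> 0 \<Longrightarrow> dist x 0 < e \<Longrightarrow> bessel_J 0 x > 0"
    by (auto simp: eventually_at)
  have "bessel_J (int m) x > 0" if "0 < x" "x < e" for m x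
    using that
  proof (induction m arbitrary: x)
    case 0
    then show ?case using e by simp
  next
    case (Suc m)
    let ?g = "\<lambda>x. x ^ Suc m * bessel_J (int (Suc m)) x"
    have "?g 0 < ?g x"
    proof (rule DERIV_pos_imp_increasing_open[where f = ?g and a = 0 and b = x])
      fix y assume y: "0 < y" "y < x"
      have "(?g has_real_derivative y ^ m * (y * bessel_J' (int (Suc m)) y + of_int (int (Suc m)) * bessel_J (int (Suc m)) y)) (at y)"
        using DERIV_mult[OF DERIV_pow[of "Suc m" y] DERIV_bessel_J[of "int (Suc m)" y]]
        by (simp add: algebra_simps)
      then have "(?g has_real_derivative y ^ m * (y * bessel_J (int m) y)) (at y)"
        unfolding bessel_J'_eq_pred by simp
      moreover have "y ^ m * (y * bessel_J (int m) y) > 0"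
        using Suc y by simp
      ultimately show "\<exists>l. (?g has_real_derivative l) (at y) \<and> l > 0" by blast
    qed (use Suc.prems in \<open>auto intro!: continuous_intros\<close>)
    then have "x ^ Suc m * bessel_J (int (Suc m)) x > 0" by simp
    then show ?case by (rule zero_less_mult_pos) (use Suc.prems in simp)
  qed
  with e(1) show ?thesis by blast
qed

lemma bessel_J'_nonzero:
  assumes "z > 0" "bessel_J (int m) z = 0"
  shows "bessel_J' (int m) z \<noteq> 0"
proof
  assume "bessel_J' (int m) z = 0"
  then have I: "((\<lambda>r. 2 * z\<^sup>2 * (bessel_J (int m) (z * r) * bessel_J (int m) (z * r) * r)) has_integral 0) {0..1}"
    using lommel_integral_square[OF assms(2)] by simp
  have h: "2 * z\<^sup>2 * (bessel_J (int m) (z * r) * bessel_J (int m) (z * r) * r) = 0" if "r \<in> {0..1}" for r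
    by (rule has_integral_0_cbox_imp_0[of 0 1 "\<lambda>r. 2 * z\<^sup>2 * (bessel_J (int m) (z * r) * bessel_J (int m) (z * r) * r)"])
       (use I that in \<open>auto intro!: continuous_intros\<close>)
  then have z: "bessel_J (int m) (z * r) = 0" if "0 < r" "r \<le> 1" for r
    using h[of r] that assms(1) by auto
  obtain e where e: "e > 0" "\<And>(m::nat) x. 0 < x \<Longrightarrow> x < e \<Longrightarrow> bessel_J (int m) x > 0"
    using bessel_J_pos_near_0 by blast
  define r where "r = min 1 (e / (2 * z))"
  have "0 < r" "r \<le> 1" "r \<le> e / (2 * z)" using e(1) assms(1) by (auto simp: r_def)
  then have "z * r < e" using e(1) assms(1) by (simp add: field_simps)
  then show False using z[of r] e(2)[of "z * r" m] \<open>0 < r\<close> \<open>r \<le> 1\<close> assms(1) by simp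
qed

lemma sturm_zero_pos:
  fixes u :: "real \<Rightarrow> real"
  assumes u: "\<And>x. x \<in> {a..a + 2 * pi} \<Longrightarrow> (u has_real_derivative u' x) (at x)"
    and u': "\<And>x. x \<in> {a..a + 2 * pi} \<Longrightarrow> (u' has_real_derivative - (q x * u x)) (at x)"
    and q: "\<And>x. x \<in> {a..a + 2 * pi} \<Longrightarrow> q x \<ge> 1 / 4"
  shows "\<exists>x\<in>{a..a + 2 * pi}. u x \<le> 0"
proof (rule ccontr)
  assume "\<not> ?thesis"
  then have pos: "\<And>x. x \<in> {a..a + 2 * pi} \<Longrightarrow> u x > 0" by force
  let ?T = "\<lambda>x. u' x * sin ((x - a) / 2) - u x * cos ((x - a) / 2) / 2"
  have "?T (a + 2 * pi) \<le> ?T a"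
  proof (rule DERIV_nonpos_imp_nonincreasing[where f = ?T and a = a and b = "a + 2 * pi"])
    fix x assume x: "a \<le> x" "x \<le> a + 2 * pi"
    then have x': "x \<in> {a..a + 2 * pi}" by simp
    have "(?T has_real_derivative (1 / 4 - q x) * u x * sin ((x - a) / 2)) (at x)"
      by (rule derivative_eq_intros u[OF x'] u'[OF x'] refl | simp)+ (simp add: field_simps)
    moreover have "sin ((x - a) / 2) \<ge> 0" using x by (intro sin_ge_zero) auto
    then have "(1 / 4 - q x) * u x * sin ((x - a) / 2) \<le> 0"
      using pos[OF x'] q[OF x'] by (intro mult_nonpos_nonneg) auto
    ultimately show "\<exists>y. (?T has_real_derivative y) (at x) \<and> y \<le> 0" by blast
  qed auto
  then show False using pos[of a] pos[of "a + 2 * pi"] by simp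
qed

lemma sturm_zero:
  fixes u :: "real \<Rightarrow> real"
  assumes u: "\<And>x. x \<in> {a..a + 2 * pi} \<Longrightarrow> (u has_real_derivative u' x) (at x)"
    and u': "\<And>x. x \<in> {a..a + 2 * pi} \<Longrightarrow> (u' has_real_derivative - (q x * u x)) (at x)"
    and q: "\<And>x. x \<in> {a..a + 2 * pi} \<Longrightarrow> q x \<ge> 1 / 4"
  shows "\<exists>x\<in>{a..a + 2 * pi}. u x = 0"
proof -
  obtain x where x: "x \<in> {a..a + 2 * pi}" "u x \<le> 0"
    using sturm_zero_pos[OF u u' q] by blast
  have "\<exists>y\<in>{a..a + 2 * pi}. - u y \<le> 0"
  proof (rule sturm_zero_pos[where u = "\<lambda>x. - u x" and u' = "\<lambda>x. - u' x" and q = q])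
    fix x assume x: "x \<in> {a..a + 2 * pi}"
    show "((\<lambda>x. - u x) has_real_derivative - u' x) (at x)"
      by (intro DERIV_minus u x)
    show "((\<lambda>x. - u' x) has_real_derivative - (q x * - u x)) (at x)"
      using DERIV_minus[OF u'[OF x]] by simp
    show "1 / 4 \<le> q x" by (rule q[OF x])
  qed
  then obtain y where y: "y \<in> {a..a + 2 * pi}" "u y \<ge> 0" by auto
  have "connected (u ` {a..a + 2 * pi})"
    by (intro connected_continuous_image connected_Icc)
       (rule DERIV_continuous_on[OF has_field_derivative_at_within[OF u]])
  from connectedD_interval[OF this imageI[OF x(1)] imageI[OF y(1)], of 0] show ?thesis
    using x(2) y(2) by auto
qed

text \<open>\<open>\<surd>x J\<^sub>m(x)\<close> solves \<open>u'' + (1 + (1/4 - m\<^sup>2) / x\<^sup>2) u = 0\<close>.\<close>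

lemma bessel_J_zeros_unbounded: "\<exists>x>a. bessel_J m x = 0"
proof -
  define b where "b = max 1 (max (a + 1) (2 * \<bar>of_int m\<bar>))"
  let ?u = "\<lambda>x. sqrt x * bessel_J m x"
  let ?u' = "\<lambda>x. (bessel_J m x / 2 + x * bessel_J' m x) / sqrt x"
  let ?q = "\<lambda>x. 1 - (of_int m ^ 2 - 1 / 4) / x\<^sup>2 :: real"
  have "\<exists>x\<in>{b..b + 2 * pi}. ?u x = 0"
  proof (rule sturm_zero[where u = ?u and u' = ?u' and q = ?q])
    fix x assume "x \<in> {b..b + 2 * pi}"
    then have x: "x > 0" "2 * \<bar>of_int m\<bar> \<le> x" by (auto simp: b_def)
    show "(?u has_real_derivative ?u' x) (at x)"
      using x by (auto intro!: derivative_eq_intros simp: field_simps)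
    have d: "((\<lambda>x. x * bessel_J' m x) has_real_derivative (of_int m ^ 2 - x\<^sup>2) / x * bessel_J m x) (at x)"
      using x by (intro bessel_ode) auto
    show "(?u' has_real_derivative - (?q x * ?u x)) (at x)"
    proof -
      have N: "((\<lambda>x. bessel_J m x / 2 + x * bessel_J' m x) has_real_derivative
          bessel_J' m x / 2 + (of_int m ^ 2 - x\<^sup>2) / x * bessel_J m x) (at x)"
        by (intro DERIV_add DERIV_cdivide DERIV_bessel_J d)
      have alg: "((p / 2 + (c - (s * s)\<^sup>2) / (s * s) * j) * s - (j / 2 + s * s * p) * (inverse s / 2)) / (s * s) =
          - ((1 - (c - 1 / 4) / (s * s)\<^sup>2) * (s * j))" if "s > 0" for s p j c :: real
        using that by (simp add: field_simps power2_eq_square)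
      have "(?u' has_real_derivative ((bessel_J' m x / 2 + (of_int m ^ 2 - x\<^sup>2) / x * bessel_J m x) * sqrt x -
          (bessel_J m x / 2 + x * bessel_J' m x) * (inverse (sqrt x) / 2)) / (sqrt x * sqrt x)) (at x)"
        using x by (intro DERIV_divide N DERIV_real_sqrt) auto
      then show ?thesis using alg[of "sqrt x"] x by simp
    qed
    have "(2 * \<bar>of_int m\<bar>)\<^sup>2 \<le> x\<^sup>2" using x by (intro power_mono) auto
    then have "4 * (of_int m ^ 2 - 1 / 4) \<le> x\<^sup>2" by (simp add: power_mult_distrib)
    moreover have "1 / 4 \<le> 1 - c / y" if "4 * c \<le> y" "y > 0" for c y :: real
      using that by (simp add: field_simps)
    moreover have "x\<^sup>2 > 0" using x by simp
    ultimately show "?q x \<ge> 1 / 4" by blast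
  qed
  then obtain x where "x \<ge> b" "?u x = 0" by auto
  then show ?thesis by (intro exI[of _ x]) (auto simp: b_def)
qed

lemma finite_bessel_J_zeros:
  "finite {x. 0 < x \<and> x \<le> a \<and> bessel_J (int m) x = 0}" (is "finite ?S")
proof (rule ccontr)
  assume inf: "infinite ?S"
  obtain e where e: "e > 0" "\<And>(m::nat) x. 0 < x \<Longrightarrow> x < e \<Longrightarrow> bessel_J (int m) x > 0"
    using bessel_J_pos_near_0 by blast
  have sub: "?S \<subseteq> {e..a}"
  proof
    fix x assume x: "x \<in> ?S"
    then have "\<not> x < e" using e(2)[of x m] by auto
    then show "x \<in> {e..a}" using x by auto
  qed
  then obtain p where p: "p \<in> {e..a}" "p islimpt ?S"
    using Heine_Borel_imp_Bolzano_Weierstrass[OF compact_Icc inf] by blast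
  have "closed {x. bessel_J (int m) x = 0}"
    by (intro closed_Collect_eq continuous_intros)
  moreover have "p islimpt {x. bessel_J (int m) x = 0}"
    using p(2) by (rule islimpt_subset) auto
  ultimately have 0: "bessel_J (int m) p = 0" by (auto simp: closed_limpt)
  have "(bessel_J (int m) has_real_derivative bessel_J' (int m) p) (at p)"
    by (rule DERIV_bessel_J)
  then have "((\<lambda>y. (bessel_J (int m) y - bessel_J (int m) p) / (y - p)) \<longlongrightarrow> bessel_J' (int m) p) (at p)"
    by (simp add: has_field_derivative_iff)
  then have "\<forall>\<^sub>F y in at p. (bessel_J (int m) y - bessel_J (int m) p) / (y - p) \<noteq> 0"
    using bessel_J'_nonzero[of p m] 0 p(1) e(1) by (intro tendsto_imp_eventually_ne) auto
  then have "\<forall>\<^sub>F y in at p. y \<notin> ?S"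
    by eventually_elim (simp add: 0)
  then show False using p(2) by (simp add: islimpt_iff_eventually)
qed

lemma ex1_nth_element:
  fixes S :: "real set"
  assumes fin: "\<And>a. finite {x \<in> S. x \<le> a}" and unb: "\<And>a. \<exists>x\<in>S. x > a" and "n \<ge> 1"
  shows "\<exists>!z. z \<in> S \<and> card {x \<in> S. x \<le> z} = n"
proof (rule ex_ex1I)
  have least: "\<exists>z\<in>S. z > a \<and> (\<forall>x\<in>S. x > a \<longrightarrow> z \<le> x)" for a
  proof -
    obtain y where y: "y \<in> S" "y > a" using unb by blast
    define T where "T = {x \<in> S. a < x \<and> x \<le> y}"
    have T: "finite T" "y \<in> T" using y by (auto simp: T_def intro: finite_subset[OF _ fin[of y]])
    then have "Min T \<in> T" by (metis Min_in empty_iff)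
    moreover have "Min T \<le> x" if "x \<in> S" "x > a" for x
    proof (cases "x \<le> y")
      case True
      then show ?thesis using that T by (intro Min_le) (auto simp: T_def)
    next
      case False
      then show ?thesis using Min_le[OF T] by linarith
    qed
    ultimately show ?thesis by (auto simp: T_def)
  qed
  obtain w where w: "\<And>x. x \<in> S \<Longrightarrow> w < x"
  proof (cases "{x \<in> S. x \<le> 0} = {}")
    case True
    then show ?thesis by (intro that[of 0]) force
  next
    case False
    show ?thesis
    proof (rule that[of "Min {x \<in> S. x \<le> 0} - 1"])
      fix x assume "x \<in> S"
      moreover have "Min {x \<in> S. x \<le> 0} \<le> 0"
        using Min_in[OF fin[of 0] False] by simp
      ultimately show "Min {x \<in> S. x \<le> 0} - 1 < x"
        using Min_le[OF fin[of 0], of x] by (cases "x \<le> 0") auto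
    qed
  qed
  show "\<exists>z. z \<in> S \<and> card {x \<in> S. x \<le> z} = n"
    using \<open>n \<ge> 1\<close>
  proof (induction n rule: nat_induct_at_least)
    case base
    obtain z where z: "z \<in> S" "\<forall>x\<in>S. x > w \<longrightarrow> z \<le> x" using least[of w] by blast
    then have "{x \<in> S. x \<le> z} = {z}" using w by (auto intro: antisym)
    then show ?case using z by auto
  next
    case (Suc n)
    then obtain y where y: "y \<in> S" "card {x \<in> S. x \<le> y} = n" by blast
    obtain z where z: "z \<in> S" "z > y" "\<forall>x\<in>S. x > y \<longrightarrow> z \<le> x" using least[of y] by blast
    then have "{x \<in> S. x \<le> z} = insert z {x \<in> S. x \<le> y}" by force
    then show ?case using z y fin[of y] by (intro exI[of _ z]) simp
  qed
  fix y z assume yz: "y \<in> S \<and> card {x \<in> S. x \<le> y} = n" "z \<in> S \<and> card {x \<in> S. x \<le> z} = n"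
  have L: "\<not> y < z" if "y \<in> S" "z \<in> S" "card {x \<in> S. x \<le> y} = card {x \<in> S. x \<le> z}" for y z
  proof
    assume "y < z"
    then have "{x \<in> S. x \<le> y} \<subset> {x \<in> S. x \<le> z}" using that by force
    from psubset_card_mono[OF fin this] show False using that by simp
  qed
  have "\<not> y < z" "\<not> z < y" using L[of y z] L[of z y] yz by auto
  then show "y = z" by simp
qed

lemma deriv_neg_at_zero:
  fixes h :: "real \<Rightarrow> real"
  assumes cont: "continuous_on {c..z} h" and "c < z" "h c > 0" "\<And>x. c \<le> x \<Longrightarrow> x < z \<Longrightarrow> h x \<noteq> 0"
    and "h z = 0" and d: "(h has_real_derivative D) (at z)" and "D \<noteq> 0"
  shows "D < 0"
proof (rule ccontr)
  assume "\<not> D < 0"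
  with \<open>D \<noteq> 0\<close> have "D > 0" by simp
  from has_real_derivative_pos_inc_left[OF d this]
  obtain \<delta> where \<delta>: "\<delta> > 0" "\<And>k. 0 < k \<Longrightarrow> k < \<delta> \<Longrightarrow> h (z - k) < 0" using \<open>h z = 0\<close> by auto
  define k where "k = min (\<delta> / 2) (z - c)"
  have k: "0 < k" "k < \<delta>" "c \<le> z - k" using \<delta>(1) \<open>c < z\<close> by (auto simp: k_def)
  have "continuous_on {c..z - k} h" using k by (intro continuous_on_subset[OF cont]) auto
  from IVT2'[OF _ _ k(3) this, of 0] obtain x where "c \<le> x" "x \<le> z - k" "h x = 0"
    using \<delta>(2)[OF k(1,2)] \<open>h c > 0\<close> by auto
  then show False using assms(4)[of x] k by auto
qed

lemma alternating_derivative_at_zeros: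
  fixes g g' :: "real \<Rightarrow> real"
  defines "S \<equiv> {x. 0 < x \<and> g x = 0}"
  assumes fin: "\<And>a. finite {x \<in> S. x \<le> a}"
    and d: "\<And>x. (g has_real_derivative g' x) (at x)"
    and simple: "\<And>x. x \<in> S \<Longrightarrow> g' x \<noteq> 0"
    and "e > 0" and pos: "\<And>x. 0 < x \<Longrightarrow> x < e \<Longrightarrow> g x > 0"
  shows "z \<in> S \<Longrightarrow> card {x \<in> S. x \<le> z} = n \<Longrightarrow> (-1) ^ n * g' z > 0"
proof (induction n arbitrary: z)
  case 0
  then show ?case using fin[of z] by auto
next
  case (Suc n)
  have cont: "continuous_on A (\<lambda>x. (-1) ^ n * g x)" for A
    by (intro continuous_on_mult_left DERIV_continuous_on[OF has_field_derivative_at_within[OF d]])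
  have d': "((\<lambda>x. (-1) ^ n * g x) has_real_derivative (-1) ^ n * g' x) (at x)" for x
    by (rule DERIV_cmult[OF d])
  have z: "z > 0" "g z = 0" "g' z \<noteq> 0" using Suc.prems simple by (auto simp: S_def)
  define T where "T = {x \<in> S. x < z}"
  have T: "finite T" using fin[of z] by (rule finite_subset[rotated]) (auto simp: T_def)
  have "{x \<in> S. x \<le> z} = insert z T" using Suc.prems by (auto simp: T_def)
  then have card_T: "card T = n" using Suc.prems T by (auto simp: T_def)
  have "\<exists>c. 0 < c \<and> c < z \<and> (-1) ^ n * g c > 0 \<and> (\<forall>x. c \<le> x \<longrightarrow> x < z \<longrightarrow> g x \<noteq> 0)"
  proof (cases "T = {}")
    case True
    then have "n = 0" using card_T by simp
    define c where "c = min (e / 2) (z / 2)"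
    have "0 < c" "c < z" "c < e" using z \<open>e > 0\<close> by (auto simp: c_def)
    moreover have "g x \<noteq> 0" if "c \<le> x" "x < z" for x
      using True that \<open>0 < c\<close> by (auto simp: T_def S_def)
    ultimately show ?thesis using \<open>n = 0\<close> pos by auto
  next
    case False
    define y where "y = Max T"
    have y: "y \<in> T" using Max_in[OF T False] by (simp add: y_def)
    have "{x \<in> S. x \<le> y} = T" using y Max_ge[OF T] by (force simp: T_def y_def)
    then have "(-1) ^ n * g' y > 0" using Suc.IH[of y] y card_T by (auto simp: T_def)
    from has_real_derivative_pos_inc_right[OF d' this]
    obtain \<delta> where \<delta>: "\<delta> > 0" "\<And>k. 0 < k \<Longrightarrow> k < \<delta> \<Longrightarrow> (-1) ^ n * g (y + k) > 0"
      using y by (auto simp: T_def S_def)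
    define k where "k = min (\<delta> / 2) ((z - y) / 2)"
    have k: "0 < k" "k < \<delta>" "y + k < z" using \<delta> y by (auto simp: k_def T_def field_simps min_def)
    moreover have "y > 0" using y by (auto simp: T_def S_def)
    moreover have "g x \<noteq> 0" if "y + k \<le> x" "x < z" for x
    proof
      assume "g x = 0"
      then have "x \<in> T" using that k \<open>y > 0\<close> by (auto simp: T_def S_def)
      then show False using Max_ge[OF T, of x] that k by (simp add: y_def)
    qed
    ultimately show ?thesis using \<delta> by (intro exI[of _ "y + k"]) auto
  qed
  then obtain c where c: "0 < c" "c < z" "(-1) ^ n * g c > 0" "\<forall>x. c \<le> x \<longrightarrow> x < z \<longrightarrow> g x \<noteq> 0" by blast
  have "(-1) ^ n * g' z < 0"
    by (rule deriv_neg_at_zero[OF cont c(2,3) _ _ d']) (use c(4) z in auto)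
  then show ?case by simp
qed

lemma bessel_J_eq_abs: "bessel_J m x = epsilon m * bessel_J (int (nat \<bar>m\<bar>)) x"
  using bessel_J_uminus[of "- m" x] by (auto simp: epsilon_def power_int_minus_one_minus)

lemma abs_epsilon [simp]: "\<bar>epsilon m\<bar> = 1"
  by (simp add: epsilon_def power_int_abs)

lemma bessel_J'_eq_abs: "bessel_J' m x = epsilon m * bessel_J' (int (nat \<bar>m\<bar>)) x"
proof (rule DERIV_unique)
  show "(bessel_J m has_real_derivative bessel_J' m x) (at x)"
    by (rule DERIV_bessel_J)
  show "(bessel_J m has_real_derivative epsilon m * bessel_J' (int (nat \<bar>m\<bar>)) x) (at x)"
    unfolding bessel_J_eq_abs[of m, abs_def] by (auto intro!: derivative_eq_intros)
qed

lemma bessel_zero_props: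
  assumes "n \<ge> 1"
  shows "bessel_zero m n > 0" (is ?A) and "bessel_J m (bessel_zero m n) = 0" (is ?B)
    and "bessel_J' m (bessel_zero m n) =
           epsilon m * (-1) ^ n * \<bar>bessel_J (m + 1) (bessel_zero m n)\<bar>" (is ?C)
    and "bessel_J' m (bessel_zero m n) \<noteq> 0" (is ?D)
proof -
  define k where "k = nat \<bar>m\<bar>"
  define S where "S = {x. 0 < x \<and> bessel_J (int k) x = 0}"
  define z where "z = bessel_zero m n"
  have e0: "epsilon m \<noteq> 0" using abs_epsilon[of m] by force
  have iff: "bessel_J m x = 0 \<longleftrightarrow> bessel_J (int k) x = 0" for x
    using e0 unfolding bessel_J_eq_abs[of m] k_def by simp
  have fin: "finite {x \<in> S. x \<le> a}" for a
    using finite_bessel_J_zeros[of a k] by (rule finite_subset[rotated]) (auto simp: S_def)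
  have unb: "\<exists>x\<in>S. x > a" for a
    using bessel_J_zeros_unbounded[of "max a 0" "int k"] by (auto simp: S_def)
  have eq: "(0 < z \<and> bessel_J m z = 0 \<and> card {x. 0 < x \<and> x \<le> z \<and> bessel_J m x = 0} = n) \<longleftrightarrow>
     (z \<in> S \<and> card {x \<in> S. x \<le> z} = n)" for z
  proof -
    have "{x. 0 < x \<and> x \<le> z \<and> bessel_J m x = 0} = {x \<in> S. x \<le> z}"
      unfolding iff by (auto simp: S_def)
    then show ?thesis by (simp add: iff) (auto simp: S_def)
  qed
  have z: "z \<in> S \<and> card {x \<in> S. x \<le> z} = n"
    unfolding z_def bessel_zero_def eq
    by (rule theI'[OF ex1_nth_element]) (use fin unb assms in auto)
  then have z0: "z > 0" "bessel_J (int k) z = 0" by (auto simp: S_def)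
  then show ?A ?B by (simp_all add: z_def[symmetric] iff)
  have nz: "bessel_J' (int k) z \<noteq> 0" using z0 by (rule bessel_J'_nonzero)
  then show ?D using e0 unfolding z_def[symmetric] bessel_J'_eq_abs[of m] k_def by simp
  obtain e where e: "e > 0" "\<And>(m::nat) x. 0 < x \<Longrightarrow> x < e \<Longrightarrow> bessel_J (int m) x > 0"
    using bessel_J_pos_near_0 by blast
  have "(-1) ^ n * bessel_J' (int k) z > 0"
  proof (rule alternating_derivative_at_zeros[of "bessel_J (int k)" "bessel_J' (int k)" e])
    show "(bessel_J (int k) has_real_derivative bessel_J' (int k) x) (at x)" for x
      by (rule DERIV_bessel_J)
  qed (use fin z e bessel_J'_nonzero in \<open>auto simp: S_def\<close>)
  then have "bessel_J' (int k) z = (-1) ^ n * \<bar>bessel_J' (int k) z\<bar>"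
    by (cases "even n") auto
  moreover have e: "bessel_J' m z = epsilon m * bessel_J' (int k) z"
    unfolding k_def by (rule bessel_J'_eq_abs)
  moreover have "\<bar>bessel_J' (int k) z\<bar> = \<bar>bessel_J (m + 1) z\<bar>"
  proof -
    have "z * bessel_J' m z = z * - bessel_J (m + 1) z"
      using bessel_J'_eq_Suc[of z m] z0 iff[of z] by simp
    then have "bessel_J' m z = - bessel_J (m + 1) z"
      using z0(1) by (simp only: mult_cancel_left) auto
    with e show ?thesis by (metis abs_epsilon abs_minus_cancel abs_mult mult_1)
  qed
  ultimately show ?C unfolding z_def[symmetric] by simp
qed

section \<open>Fourier-Bessel coefficients of waves\<close>

lemma continuous_on_section:
  fixes f :: "real \<Rightarrow> real \<Rightarrow> complex"
  assumes "continuous_on UNIV (\<lambda>p. f (fst p) (snd p))"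
  shows "continuous_on S (\<lambda>y. f x y)"
  by (rule continuous_on_compose2[OF assms, of _ "\<lambda>y. (x, y)", simplified]) (auto intro!: continuous_intros)

lemma continuous_on_integral_section:
  fixes f :: "real \<Rightarrow> real \<Rightarrow> complex"
  assumes "continuous_on UNIV (\<lambda>p. f (fst p) (snd p))"
  shows "continuous_on S (\<lambda>x. integral {a..b} (f x))"
  unfolding cbox_interval[symmetric]
  by (rule integral_continuous_on_param)
     (use assms in \<open>auto simp: case_prod_unfold intro: continuous_on_subset\<close>)

definition FB_integrand :: "(real \<times> real \<Rightarrow> complex) \<Rightarrow> int \<Rightarrow> nat \<Rightarrow> real \<Rightarrow> real \<Rightarrow> complex" where
  "FB_integrand f m n \<theta> r = f (r * cos \<theta>, r * sin \<theta>) *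
     (cis (- of_int m * \<theta>) * of_real (bessel_J m (bessel_zero m n * r) * r /
       (sqrt pi * \<bar>bessel_J (m + 1) (bessel_zero m n)\<bar>)))"

lemma FB_coeff_eq:
  "FB_coeff f m n = integral {0..2 * pi} (\<lambda>\<theta>. integral {0..1} (FB_integrand f m n \<theta>))"
  unfolding FB_coeff_def
  by (intro integral_cong) (simp add: Psi_polar_def FB_integrand_def cis_cnj)

lemma continuous_on_FB_integrand:
  assumes "continuous_on UNIV f"
  shows "continuous_on UNIV (\<lambda>p. FB_integrand f m n (fst p) (snd p))"
proof -
  define c where "c = 1 / (sqrt pi * \<bar>bessel_J (m + 1) (bessel_zero m n)\<bar>)"
  have "FB_integrand f m n \<theta> r = f (r * cos \<theta>, r * sin \<theta>) *
      (cis (- of_int m * \<theta>) * of_real (bessel_J m (bessel_zero m n * r) * r * c))" for \<theta> r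
    by (simp add: FB_integrand_def c_def)
  then show ?thesis
    by (auto intro!: continuous_intros continuous_on_compose2[OF assms])
qed

lemmas FB_integrand_integrable =
  integrable_continuous_real[OF continuous_on_section[OF continuous_on_FB_integrand]]
  integrable_continuous_real[OF continuous_on_integral_section[OF continuous_on_FB_integrand]]

lemma FB_coeff_add:
  assumes "continuous_on UNIV f" "continuous_on UNIV g"
  shows "FB_coeff (\<lambda>x. f x + g x) m n = FB_coeff f m n + FB_coeff g m n"
proof -
  have "FB_integrand (\<lambda>x. f x + g x) m n \<theta> = (\<lambda>r. FB_integrand f m n \<theta> r + FB_integrand g m n \<theta> r)" for \<theta>
    by (intro ext) (simp only: FB_integrand_def distrib_right)
  then show ?thesis
    unfolding FB_coeff_eq by (simp add: integral_add FB_integrand_integrable assms)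
qed

lemma FB_coeff_mult: "FB_coeff (\<lambda>x. c * f x) m n = c * FB_coeff f m n"
proof -
  have "FB_integrand (\<lambda>x. c * f x) m n \<theta> = (\<lambda>r. c * FB_integrand f m n \<theta> r)" for \<theta>
    by (simp add: FB_integrand_def fun_eq_iff)
  then show ?thesis unfolding FB_coeff_eq by simp
qed

lemma FB_coeff_sum:
  assumes "finite I" "\<And>i. i \<in> I \<Longrightarrow> continuous_on UNIV (h i)"
  shows "FB_coeff (\<lambda>x. \<Sum>i\<in>I. h i x) m n = (\<Sum>i\<in>I. FB_coeff (h i) m n)"
  using assms
proof (induction I rule: finite_induct)
  case empty
  show ?case using FB_coeff_mult[of 0 "\<lambda>x. 0" m n] by simp
next
  case (insert i I)
  then show ?case by (simp add: FB_coeff_add continuous_on_sum)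
qed

lemma norm_FB_coeff_le:
  assumes "continuous_on UNIV g" "G \<ge> 0" "\<And>x. norm x \<le> 1 \<Longrightarrow> norm (g x) \<le> G"
  shows "norm (FB_coeff g m n) \<le> 2 * pi / (sqrt pi * \<bar>bessel_J (m + 1) (bessel_zero m n)\<bar>) * G"
proof -
  define d where "d = sqrt pi * \<bar>bessel_J (m + 1) (bessel_zero m n)\<bar>"
  have d: "d \<ge> 0" by (simp add: d_def)
  have b: "norm (FB_integrand g m n \<theta> r) \<le> G / d" if "r \<in> {0..1}" for \<theta> r
  proof -
    have "norm (r * cos \<theta>, r * sin \<theta>) = \<bar>r\<bar> * sqrt ((cos \<theta>)\<^sup>2 + (sin \<theta>)\<^sup>2)"
      by (simp add: norm_prod_def power_mult_distrib real_sqrt_mult flip: distrib_left)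
    then have "norm (r * cos \<theta>, r * sin \<theta>) \<le> 1" using that by simp
    then have "norm (g (r * cos \<theta>, r * sin \<theta>)) \<le> G" by (rule assms(3))
    moreover have "\<bar>bessel_J m (bessel_zero m n * r)\<bar> * \<bar>r\<bar> \<le> 1 * 1"
      using that abs_bessel_J_le by (intro mult_mono) auto
    then have "\<bar>bessel_J m (bessel_zero m n * r) * r / d\<bar> \<le> 1 * 1 / d"
      using d by (simp add: abs_mult divide_right_mono)
    ultimately have "norm (g (r * cos \<theta>, r * sin \<theta>)) * \<bar>bessel_J m (bessel_zero m n * r) * r / d\<bar> \<le> G * (1 * 1 / d)"
      using assms(2) by (intro mult_mono) auto
    moreover have "norm (FB_integrand g m n \<theta> r) =
        norm (g (r * cos \<theta>, r * sin \<theta>)) * \<bar>bessel_J m (bessel_zero m n * r) * r / d\<bar>"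
      by (simp only: FB_integrand_def norm_mult norm_cis norm_of_real mult_1 d_def)
    ultimately show ?thesis by simp
  qed
  have "norm (integral {0..1} (FB_integrand g m n \<theta>)) \<le> G / d * (1 - 0)" for \<theta>
    by (rule integral_bound) (auto intro!: b continuous_on_section continuous_on_FB_integrand assms(1))
  then have "norm (FB_coeff g m n) \<le> G / d * (2 * pi - 0)"
    unfolding FB_coeff_eq
    by (intro integral_bound)
       (auto intro!: continuous_on_integral_section continuous_on_FB_integrand assms(1))
  then show ?thesis by (simp add: d_def mult_ac)
qed

definition wave :: "int \<times> int \<Rightarrow> real \<times> real \<Rightarrow> complex" where
  "wave k x = cis (pi * (of_int (fst k) * fst x + of_int (snd k) * snd x))"

lemma continuous_on_wave [continuous_intros]: "continuous_on S (wave k)"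
  unfolding wave_def by (intro continuous_intros)

lemma freq_vec_polar:
  "of_int (fst k) = norm (freq_vec k) * cos (polar_angle (freq_vec k))"
  "of_int (snd k) = norm (freq_vec k) * sin (polar_angle (freq_vec k))"
proof -
  let ?z = "Complex (of_int (fst k)) (of_int (snd k))"
  have "norm (freq_vec k) = cmod ?z" by (simp add: freq_vec_def norm_prod_def complex_norm)
  moreover have "rcis (cmod ?z) (Arg ?z) = ?z" by (rule rcis_cmod_Arg)
  ultimately show "of_int (fst k) = norm (freq_vec k) * cos (polar_angle (freq_vec k))"
    "of_int (snd k) = norm (freq_vec k) * sin (polar_angle (freq_vec k))"
    by (auto simp: complex_eq_iff polar_angle_def freq_vec_def)
qed

lemma bessel_quotient_integral:
  fixes m :: int
  assumes "n \<ge> 1" "a \<ge> 0"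
  defines "z \<equiv> bessel_zero m n"
  shows "((\<lambda>r. bessel_J m (a * r) * bessel_J m (z * r) * r) has_integral
    z * bessel_J' m z * bessel_quotient m n a) {0..1}"
proof (cases "a = z")
  case True
  have z: "z > 0" "bessel_J m z = 0" using bessel_zero_props[OF assms(1)] by (auto simp: z_def)
  have "((\<lambda>r. 1 / (2 * z\<^sup>2) * (2 * z\<^sup>2 * (bessel_J m (z * r) * bessel_J m (z * r) * r))) has_integral
      1 / (2 * z\<^sup>2) * (z * bessel_J' m z)\<^sup>2) {0..1}"
    by (intro has_integral_mult_right lommel_integral_square z)
  then show ?thesis using z True
    by (simp add: bessel_quotient_def z_def[symmetric] deriv_bessel_J power_mult_distrib power2_eq_square)
next
  case False
  have z: "z > 0" "bessel_J m z = 0" using bessel_zero_props[OF assms(1)] by (auto simp: z_def)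
  have nz: "a\<^sup>2 - z\<^sup>2 \<noteq> 0" using False z assms(2) by (auto simp: power2_eq_iff)
  have "((\<lambda>r. 1 / (a\<^sup>2 - z\<^sup>2) * ((a\<^sup>2 - z\<^sup>2) * (bessel_J m (a * r) * bessel_J m (z * r) * r))) has_integral
      1 / (a\<^sup>2 - z\<^sup>2) * (z * bessel_J m a * bessel_J' m z)) {0..1}"
    by (intro has_integral_mult_right lommel_integral z)
  then show ?thesis using nz False
    by (simp add: bessel_quotient_def z_def[symmetric] mult_ac)
qed

lemma FB_coeff_wave:
  assumes "n \<ge> 1"
  shows "FB_coeff (wave k) m n = 4 * FFB_weight k m n"
proof -
  define \<rho> where "\<rho> = norm (freq_vec k)"
  define \<Phi> where "\<Phi> = polar_angle (freq_vec k)"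
  define z where "z = bessel_zero m n"
  define d where "d = \<bar>bessel_J (m + 1) z\<bar>"
  have z: "z > 0" "bessel_J' m z = epsilon m * (-1) ^ n * d" "bessel_J' m z \<noteq> 0"
    using bessel_zero_props[OF assms, of m] by (auto simp: z_def d_def)
  then have d: "d \<noteq> 0" by auto
  define c where "c = of_real (2 * pi) * \<i> powi m * cis (- of_int m * \<Phi>)"
  have w: "wave k (r * cos \<theta>, r * sin \<theta>) = cis (pi * \<rho> * r * cos (\<theta> - \<Phi>))" for r \<theta>
    unfolding wave_def freq_vec_polar[of k] \<rho>_def \<Phi>_def
    by (simp add: cos_diff algebra_simps)
  have "FB_coeff (wave k) m n = integral {0..1} (\<lambda>r. integral {0..2 * pi} (\<lambda>\<theta>. FB_integrand (wave k) m n \<theta> r))"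
    unfolding FB_coeff_eq cbox_interval[symmetric]
    by (rule integral_swap_continuous)
       (auto simp: case_prod_unfold intro!: continuous_on_subset[OF continuous_on_FB_integrand] continuous_intros)
  also have "\<dots> = integral {0..1} (\<lambda>r. c / of_real (sqrt pi * d) *
      of_real (bessel_J m (pi * \<rho> * r) * bessel_J m (z * r) * r))"
  proof (intro integral_cong)
    fix r :: real
    have "(\<lambda>\<theta>. FB_integrand (wave k) m n \<theta> r) = (\<lambda>\<theta>. of_real (bessel_J m (z * r) * r / (sqrt pi * d)) *
       (cis (pi * \<rho> * r * cos (\<theta> - \<Phi>)) * cis (- of_int m * \<theta>)))"
      by (simp add: FB_integrand_def w z_def d_def mult_ac fun_eq_iff)
    then have "integral {0..2 * pi} (\<lambda>\<theta>. FB_integrand (wave k) m n \<theta> r) =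
       of_real (bessel_J m (z * r) * r / (sqrt pi * d)) * (c * of_real (bessel_J m (pi * \<rho> * r)))"
      by (simp only: integral_mult_right bessel_integral c_def)
    then show "integral {0..2 * pi} (\<lambda>\<theta>. FB_integrand (wave k) m n \<theta> r) =
      c / of_real (sqrt pi * d) * of_real (bessel_J m (pi * \<rho> * r) * bessel_J m (z * r) * r)"
      by simp
  qed
  also have "\<dots> = c / of_real (sqrt pi * d) * of_real (z * bessel_J' m z * bessel_quotient m n (pi * \<rho>))"
  proof -
    have "((\<lambda>r. complex_of_real (bessel_J m (pi * \<rho> * r) * bessel_J m (z * r) * r)) has_integral
       of_real (z * bessel_J' m z * bessel_quotient m n (pi * \<rho>))) {0..1}"
      using bessel_quotient_integral[OF assms, of "pi * \<rho>" m]
      by (intro has_integral_of_real) (simp add: \<rho>_def z_def)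
    then show ?thesis
      by (simp only: integral_mult_right integral_unique)
  qed
  also have "\<dots> = of_real (2 * pi / sqrt pi) * (of_real (epsilon m * (-1) ^ n) * \<i> powi m * of_real z *
      (of_real (bessel_quotient m n (pi * \<rho>)) * cis (- of_int m * \<Phi>)))"
    using d by (simp add: z(2) c_def field_simps)
  also have "2 * pi / sqrt pi = 2 * sqrt pi"
    by (simp add: real_div_sqrt field_simps)
  finally show ?thesis
    by (simp add: FFB_weight_def z_def[symmetric] \<rho>_def[symmetric] \<Phi>_def[symmetric])
qed

lemma bessel_quotient_bound:
  assumes "n \<ge> 1"
  shows "\<exists>C\<ge>0. \<forall>a\<ge>0. \<bar>bessel_quotient m n a\<bar> * (1 + a\<^sup>2) \<le> C"
proof -
  define z where "z = bessel_zero m n"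
  define j where "j = \<bar>z * bessel_J' m z\<bar>"
  have z: "z > 0" "bessel_J' m z \<noteq> 0" using bessel_zero_props[OF assms] by (auto simp: z_def)
  then have j: "j > 0" by (simp add: j_def)
  have "\<bar>bessel_quotient m n a\<bar> * (1 + a\<^sup>2) \<le> 2 + (2 * z\<^sup>2 + 2) / j" if "a \<ge> 0" for a
  proof (cases "a\<^sup>2 \<ge> 2 * z\<^sup>2 + 1")
    case True
    have "0 \<le> z\<^sup>2" by simp
    then have pos: "a\<^sup>2 - z\<^sup>2 > 0" using True by linarith
    have le: "1 + a\<^sup>2 \<le> 2 * (a\<^sup>2 - z\<^sup>2)" using True by simp
    from pos have "a \<noteq> z" by auto
    then have "\<bar>bessel_quotient m n a\<bar> * (1 + a\<^sup>2) = \<bar>bessel_J m a\<bar> * ((1 + a\<^sup>2) / (a\<^sup>2 - z\<^sup>2))"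
      using pos by (simp add: bessel_quotient_def z_def[symmetric])
    also have "\<dots> \<le> 1 * 2"
      using pos le abs_bessel_J_le by (intro mult_mono) (auto simp: divide_le_eq)
    finally show ?thesis using j by (simp add: add_increasing2)
  next
    case False
    have "norm (integral {0..1} (\<lambda>r. bessel_J m (a * r) * bessel_J m (z * r) * r)) \<le> 1 * (1 - 0)"
    proof (rule integral_bound)
      fix r :: real assume "r \<in> {0..1}"
      then have "\<bar>bessel_J m (a * r)\<bar> * \<bar>bessel_J m (z * r)\<bar> * \<bar>r\<bar> \<le> 1 * 1 * 1"
        using abs_bessel_J_le by (intro mult_mono) auto
      then show "norm (bessel_J m (a * r) * bessel_J m (z * r) * r) \<le> 1" by (simp add: abs_mult)
    qed (auto intro!: continuous_intros)
    then have "j * \<bar>bessel_quotient m n a\<bar> \<le> 1"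
      using integral_unique[OF bessel_quotient_integral[OF assms that, of m]]
      by (simp add: z_def[symmetric] j_def abs_mult)
    then have "\<bar>bessel_quotient m n a\<bar> \<le> 1 / j" using j by (simp add: field_simps)
    then have "\<bar>bessel_quotient m n a\<bar> * (1 + a\<^sup>2) \<le> 1 / j * (2 * z\<^sup>2 + 2)"
      using False j by (intro mult_mono) auto
    then show ?thesis by simp
  qed
  then show ?thesis using j by (intro exI[of _ "2 + (2 * z\<^sup>2 + 2) / j"]) auto
qed

lemma FFB_weight_bound:
  assumes "n \<ge> 1"
  shows "\<exists>C\<ge>0. \<forall>k. (norm (FFB_weight k m n))\<^sup>2 \<le> C / ((1 + (of_int (fst k))\<^sup>2) * (1 + (of_int (snd k))\<^sup>2))"
proof -
  obtain C where C: "C \<ge> 0" "\<And>a. a \<ge> 0 \<Longrightarrow> \<bar>bessel_quotient m n a\<bar> * (1 + a\<^sup>2) \<le> C"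
    using bessel_quotient_bound[OF assms] by blast
  define z where "z = bessel_zero m n"
  have z: "z > 0" using bessel_zero_props[OF assms] by (auto simp: z_def)
  define D where "D = (sqrt pi * z / 2 * C)\<^sup>2"
  have "(norm (FFB_weight k m n))\<^sup>2 \<le> D / ((1 + (of_int (fst k))\<^sup>2) * (1 + (of_int (snd k))\<^sup>2))" for k
  proof -
    let ?a = "pi * norm (freq_vec k)"
    have "(norm (freq_vec k))\<^sup>2 = (of_int (fst k))\<^sup>2 + (of_int (snd k))\<^sup>2"
      by (simp add: freq_vec_def norm_prod_def)
    moreover have "1 * (norm (freq_vec k))\<^sup>2 \<le> pi\<^sup>2 * (norm (freq_vec k))\<^sup>2"
      using pi_ge_two by (intro mult_right_mono one_le_power) auto
    ultimately have le: "1 + (of_int (fst k))\<^sup>2 \<le> 1 + ?a\<^sup>2" "1 + (of_int (snd k))\<^sup>2 \<le> 1 + ?a\<^sup>2"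
      by (simp_all add: power_mult_distrib) (smt (verit) zero_le_power2)+
    have "norm (FFB_weight k m n) = sqrt pi * z / 2 * \<bar>bessel_quotient m n ?a\<bar>"
      using z by (simp add: FFB_weight_def z_def[symmetric] norm_mult norm_divide norm_power abs_mult)
    also have "\<dots> * (1 + ?a\<^sup>2) \<le> sqrt pi * z / 2 * C"
      unfolding mult.assoc using C(2)[of ?a] z by (intro mult_left_mono) auto
    finally have sq: "(norm (FFB_weight k m n) * (1 + ?a\<^sup>2))\<^sup>2 \<le> D"
      unfolding D_def by (intro power_mono) auto
    have "(norm (FFB_weight k m n))\<^sup>2 * ((1 + (of_int (fst k))\<^sup>2) * (1 + (of_int (snd k))\<^sup>2)) \<le>
        (norm (FFB_weight k m n))\<^sup>2 * ((1 + ?a\<^sup>2) * (1 + ?a\<^sup>2))"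
      using le by (intro mult_left_mono mult_mono) auto
    also have "\<dots> = (norm (FFB_weight k m n) * (1 + ?a\<^sup>2))\<^sup>2"
      by (simp only: power2_eq_square mult_ac)
    also note sq
    finally have "(norm (FFB_weight k m n))\<^sup>2 * ((1 + (of_int (fst k))\<^sup>2) * (1 + (of_int (snd k))\<^sup>2)) \<le> D" .
    moreover have "(1 + (of_int (fst k))\<^sup>2) * (1 + (of_int (snd k))\<^sup>2) > (0 :: real)"
      by (intro mult_pos_pos) (auto intro: add_pos_nonneg)
    ultimately show ?thesis by (simp add: pos_le_divide_eq)
  qed
  moreover have "D \<ge> 0" by (simp add: D_def)
  ultimately show ?thesis by blast
qed

lemma sum_inverse_squares_le: "(\<Sum>j = - int K..int K. 1 / (1 + (of_int j)\<^sup>2)) \<le> 5 - 4 / (2 * real K + 1)"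
proof (induction K)
  case 0
  then show ?case by simp
next
  case (Suc K)
  have "{- int (Suc K)..int (Suc K)} = insert (- int (Suc K)) (insert (int (Suc K)) {- int K..int K})"
    by auto
  then have "(\<Sum>j = - int (Suc K)..int (Suc K). 1 / (1 + (of_int j)\<^sup>2)) =
      2 / (1 + (real K + 1)\<^sup>2) + (\<Sum>j = - int K..int K. 1 / (1 + (of_int j)\<^sup>2) :: real)"
    by (simp add: power2_eq_square algebra_simps)
  moreover have "2 / (1 + (real K + 1)\<^sup>2) \<le> 8 / ((2 * real K + 1) * (2 * real K + 3))"
  proof -
    have "2 / x = 8 / (4 * x)" for x :: real by simp
    then have "2 / (1 + (real K + 1)\<^sup>2) = 8 / (4 * (1 + (real K + 1)\<^sup>2))" .
    also have "\<dots> \<le> 8 / ((2 * real K + 1) * (2 * real K + 3))"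
      by (intro divide_left_mono mult_pos_pos add_pos_nonneg add_nonneg_pos) (auto simp: power2_eq_square algebra_simps)
    finally show ?thesis .
  qed
  moreover have "8 / ((2 * real K + 1) * (2 * real K + 3)) = 4 / (2 * real K + 1) - 4 / (2 * real K + 3)"
    by (simp add: field_simps)
  ultimately show ?case using Suc by (simp add: algebra_simps)
qed

lemma sum_FFB_weight_square_bound:
  assumes "n \<ge> 1"
  shows "\<exists>C\<ge>0. \<forall>K. (\<Sum>k\<in>{- int K..int K} \<times> {- int K..int K}. (norm (FFB_weight k m n))\<^sup>2) \<le> C\<^sup>2"
proof -
  obtain C where C: "C \<ge> 0" "\<And>k. (norm (FFB_weight k m n))\<^sup>2 \<le> C / ((1 + (of_int (fst k))\<^sup>2) * (1 + (of_int (snd k))\<^sup>2))"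
    using FFB_weight_bound[OF assms] by blast
  have "(\<Sum>k\<in>{- int K..int K} \<times> {- int K..int K}. (norm (FFB_weight k m n))\<^sup>2) \<le> (sqrt (C * 25))\<^sup>2" for K
  proof -
    let ?s = "\<Sum>j = - int K..int K. 1 / (1 + (of_int j)\<^sup>2) :: real"
    have "(\<Sum>k\<in>{- int K..int K} \<times> {- int K..int K}. (norm (FFB_weight k m n))\<^sup>2) \<le>
      (\<Sum>k\<in>{- int K..int K} \<times> {- int K..int K}. C * (1 / (1 + (of_int (fst k))\<^sup>2) * (1 / (1 + (of_int (snd k))\<^sup>2))))"
      using C(2) by (intro sum_mono) simp
    also have "\<dots> = C * (?s * ?s)"
      by (simp only: sum_distrib_left[symmetric] sum_product sum.cartesian_product' fst_conv snd_conv case_prod_unfold)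
    also have "?s \<le> 5"
      by (rule order_trans[OF sum_inverse_squares_le]) simp
    then have "C * (?s * ?s) \<le> C * (5 * 5)"
      using C(1) by (intro mult_left_mono mult_mono sum_nonneg) auto
    finally show ?thesis using C(1) by simp
  qed
  then show ?thesis using C(1) by (intro exI[of _ "sqrt (C * 25)"]) simp
qed

section \<open>The finite transform\<close>

lemma sum_cis_roots:
  assumes "L > 0"
  shows "(\<Sum>l<L. cis (2 * pi * of_int d * real l / real L)) = (if int L dvd d then of_nat L else 0)"
proof -
  define \<omega> where "\<omega> = cis (2 * pi * of_int d / real L)"
  have pow: "cis (2 * pi * of_int d * real l / real L) = \<omega> ^ l" for l
    by (simp add: \<omega>_def Complex.DeMoivre mult_ac)
  have "\<omega> ^ L = 1"
    using assms cis_multiple_2pi[of "of_int d"] by (simp add: \<omega>_def Complex.DeMoivre)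
  moreover have "\<omega> = 1 \<longleftrightarrow> int L dvd d"
  proof
    assume "\<omega> = 1"
    then have "cos (2 * pi * of_int d / real L) = 1"
      by (auto simp: \<omega>_def complex_eq_iff)
    then obtain j :: int where "2 * pi * of_int d / real L = of_int j * 2 * pi"
      unfolding cos_one_2pi_int by blast
    then have "of_int d = (of_int (j * int L) :: real)" using assms by (simp add: field_simps)
    then have "d = j * int L" unfolding of_int_eq_iff .
    then show "int L dvd d" by simp
  next
    assume "int L dvd d"
    then obtain j where "d = int L * j" by auto
    then have "2 * pi * of_int d / real L = 2 * pi * of_int j" using assms by simp
    then show "\<omega> = 1" unfolding \<omega>_def using cis_multiple_2pi[of "of_int j"] by simp
  qed
  ultimately show ?thesis unfolding pow by (simp add: sum_gp_strict)
qed

lemma sum_cis_grid: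
  assumes "L > 0"
  shows "(\<Sum>i = 1..L. cis (pi * of_int d * grid_point L i)) =
    (if int L dvd d then of_nat L * (-1) powi d else 0)"
proof -
  have "(\<Sum>i = 1..L. cis (pi * of_int d * grid_point L i)) =
      (\<Sum>l<L. cis (pi * of_int d * grid_point L (Suc l)))"
    by (rule sum.reindex_bij_witness[of _ Suc "\<lambda>i. i - 1"]) auto
  also have "\<dots> = (\<Sum>l<L. cis (- (of_int d * pi)) * cis (2 * pi * of_int d * real l / real L))"
    by (simp add: grid_point_def cis_mult algebra_simps)
  also have "cis (- (of_int d * pi)) = (-1) powi d"
    using cis_power_int[of pi "- d"] by (simp add: power_int_minus_one_minus)
  finally show ?thesis
    unfolding sum_distrib_left[symmetric] sum_cis_roots[OF assms] by simp
qed

lemma sum_cis_grid_orthogonal: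
  assumes "\<bar>d\<bar> < int L"
  shows "(\<Sum>i = 1..L. cis (pi * of_int d * grid_point L i)) = (if d = 0 then of_nat L else 0)"
proof -
  have "int L dvd d \<longleftrightarrow> d = 0" using assms dvd_imp_le_int[of d "int L"] by auto
  then show ?thesis using assms by (subst sum_cis_grid) auto
qed

lemma sum_cis_freq_orthogonal:
  assumes L: "L = 2 * K + 1" and "i \<in> {1..L}" "j \<in> {1..L}"
  shows "(\<Sum>k = - int K..int K. cis (pi * of_int k * (grid_point L i - grid_point L j))) =
     (if i = j then of_nat L else 0)"
proof -
  define d where "d = int i - int j"
  have "L > 0" using L by simp
  have "(\<Sum>k = - int K..int K. cis (pi * of_int k * (grid_point L i - grid_point L j))) =
      (\<Sum>l<L. cis (pi * of_int (int l - int K) * (grid_point L i - grid_point L j)))"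
    by (rule sum.reindex_bij_witness[of _ "\<lambda>l. int l - int K" "\<lambda>k. nat (k + int K)"]) (auto simp: L)
  also have "\<dots> = (\<Sum>l<L. cis (- (2 * pi * of_int d * real K / real L)) * cis (2 * pi * of_int d * real l / real L))"
  proof (rule sum.cong)
    fix l
    have "pi * of_int (int l - int K) * (grid_point L i - grid_point L j) =
      - (2 * pi * of_int d * real K / real L) + 2 * pi * of_int d * real l / real L"
      using \<open>L > 0\<close> by (simp add: grid_point_def d_def field_simps)
    then show "cis (pi * of_int (int l - int K) * (grid_point L i - grid_point L j)) =
      cis (- (2 * pi * of_int d * real K / real L)) * cis (2 * pi * of_int d * real l / real L)"
      unfolding cis_mult by (rule arg_cong)
  qed simp
  also have "\<dots> = (if i = j then of_nat L else 0)"
  proof -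
    have "1 \<le> i" "i \<le> L" "1 \<le> j" "j \<le> L" using assms by auto
    then have "\<bar>d\<bar> < int L" using d_def by arith
    then have "int L dvd d \<longleftrightarrow> d = 0" using dvd_imp_le_int[of d "int L"] by auto
    then have "int L dvd d \<longleftrightarrow> i = j" by (simp add: d_def)
    then show ?thesis
      unfolding sum_distrib_left[symmetric] sum_cis_roots[OF \<open>L > 0\<close>] by (auto simp: d_def)
  qed
  finally show ?thesis .
qed

lemma parseval_finite:
  fixes \<phi> :: "'a \<Rightarrow> 'b \<Rightarrow> complex"
  assumes "finite A"
    and "\<And>a a'. a \<in> A \<Longrightarrow> a' \<in> A \<Longrightarrow> (\<Sum>b\<in>B. \<phi> a b * cnj (\<phi> a' b)) = (if a = a' then of_real c else 0)"
  shows "(\<Sum>b\<in>B. (norm (\<Sum>a\<in>A. u a * \<phi> a b))\<^sup>2) = c * (\<Sum>a\<in>A. (norm (u a))\<^sup>2)"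
proof -
  have "complex_of_real (\<Sum>b\<in>B. (norm (\<Sum>a\<in>A. u a * \<phi> a b))\<^sup>2) =
      (\<Sum>b\<in>B. (\<Sum>a\<in>A. u a * \<phi> a b) * cnj (\<Sum>a\<in>A. u a * \<phi> a b))"
    by (simp only: of_real_sum complex_norm_square)
  also have "\<dots> = (\<Sum>b\<in>B. \<Sum>a\<in>A. \<Sum>a'\<in>A. u a * cnj (u a') * (\<phi> a b * cnj (\<phi> a' b)))"
    by (simp add: sum_product mult_ac)
  also have "\<dots> = (\<Sum>a\<in>A. \<Sum>b\<in>B. \<Sum>a'\<in>A. u a * cnj (u a') * (\<phi> a b * cnj (\<phi> a' b)))"
    by (rule sum.swap)
  also have "\<dots> = (\<Sum>a\<in>A. \<Sum>a'\<in>A. u a * cnj (u a') * (\<Sum>b\<in>B. \<phi> a b * cnj (\<phi> a' b)))"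
    unfolding sum_distrib_left by (intro sum.cong refl sum.swap)
  also have "\<dots> = (\<Sum>a\<in>A. \<Sum>a'\<in>A. if a = a' then u a * cnj (u a') * of_real c else 0)"
    using assms(2) by (intro sum.cong refl) auto
  also have "\<dots> = (\<Sum>a\<in>A. u a * cnj (u a) * of_real c)"
    using assms(1) by (intro sum.cong refl) (simp add: sum.delta')
  also have "\<dots> = of_real (c * (\<Sum>a\<in>A. (norm (u a))\<^sup>2))"
    by (simp only: of_real_mult of_real_sum complex_norm_square sum_distrib_left mult_ac)
  finally show ?thesis unfolding of_real_eq_iff .
qed

abbreviation freq_box :: "nat \<Rightarrow> (int \<times> int) set" where
  "freq_box K \<equiv> {- int K..int K} \<times> {- int K..int K}"

lemma finite_fourier_eq:
  "finite_fourier g L k = of_real ((2 / real L)\<^sup>2) * (\<Sum>p\<in>{1..L} \<times> {1..L}.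
     g (grid_point L (fst p), grid_point L (snd p)) *
       cnj (wave k (grid_point L (fst p), grid_point L (snd p))))"
proof -
  have "exp (- (of_real pi * \<i> * of_real (of_int (fst k) * x + of_int (snd k) * y))) = cnj (wave k (x, y))" for x y :: real
    unfolding wave_def cis_cnj unfolding cis_conv_exp by (simp add: mult_ac)
  then show ?thesis
    unfolding finite_fourier_def by (simp only: sum.cartesian_product case_prod_unfold)
qed

lemma finite_fourier_wave:
  assumes L: "L = 2 * K + 1" and "k \<in> freq_box K" "k' \<in> freq_box K"
  shows "finite_fourier (wave k) L k' = (if k = k' then 4 else 0)"
proof -
  obtain k1 k2 where k: "k = (k1, k2)" by force
  obtain k1' k2' where k': "k' = (k1', k2')" by force
  have "(\<Sum>p\<in>{1..L} \<times> {1..L}. wave k (grid_point L (fst p), grid_point L (snd p)) *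
       cnj (wave k' (grid_point L (fst p), grid_point L (snd p)))) =
    (\<Sum>p\<in>{1..L} \<times> {1..L}. cis (pi * of_int (k1 - k1') * grid_point L (fst p)) *
       cis (pi * of_int (k2 - k2') * grid_point L (snd p)))"
    by (intro sum.cong refl) (simp add: wave_def k k' cis_cnj cis_mult algebra_simps)
  also have "\<dots> = (\<Sum>i = 1..L. cis (pi * of_int (k1 - k1') * grid_point L i)) *
      (\<Sum>i = 1..L. cis (pi * of_int (k2 - k2') * grid_point L i))"
    by (simp only: sum_product sum.cartesian_product' fst_conv snd_conv case_prod_unfold)
  also have "\<dots> = (if k1 = k1' then of_nat L else 0) * (if k2 = k2' then of_nat L else 0)"
    using assms unfolding k k' by (subst (1 2) sum_cis_grid_orthogonal) auto
  finally have "finite_fourier (wave k) L k' =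
      of_real ((2 / real L)\<^sup>2) * ((if k1 = k1' then of_nat L else 0) * (if k2 = k2' then of_nat L else 0))"
    unfolding finite_fourier_eq by (simp only:)
  moreover have "(2 / real L)\<^sup>2 * (real L * real L) = 4"
    by (simp add: power2_eq_square L)
  then have "of_real ((2 / real L)\<^sup>2) * (of_nat L * of_nat L) = (4 :: complex)"
    by (metis of_real_mult of_real_numeral of_real_of_nat_eq)
  ultimately show ?thesis by (auto simp: k k')
qed

lemma FFB_coeff_wave:
  assumes "k \<in> freq_box K"
  shows "FFB_coeff K (wave k) m n = 4 * FFB_weight k m n"
proof -
  have "FFB_coeff K (wave k) m n = (\<Sum>k'\<in>freq_box K. if k = k' then FFB_weight k' m n * 4 else 0)"
    unfolding FFB_coeff_def
  proof (intro sum.cong refl)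
    fix k' assume "k' \<in> freq_box K"
    show "FFB_weight k' m n * finite_fourier (wave k) (2 * K + 1) k' = (if k = k' then FFB_weight k' m n * 4 else 0)"
      unfolding finite_fourier_wave[OF refl assms \<open>k' \<in> freq_box K\<close>] by simp
  qed
  also have "\<dots> = FFB_weight k m n * 4"
    using assms by (subst sum.delta') auto
  finally show ?thesis by simp
qed

lemma FFB_coeff_mult: "FFB_coeff K (\<lambda>x. c * f x) m n = c * FFB_coeff K f m n"
  unfolding FFB_coeff_def finite_fourier_eq by (simp add: sum_distrib_left mult_ac)

lemma FFB_coeff_sum:
  "FFB_coeff K (\<lambda>x. \<Sum>i\<in>I. h i x) m n = (\<Sum>i\<in>I. FFB_coeff K (h i) m n)"
proof -
  have "finite_fourier (\<lambda>x. \<Sum>i\<in>I. h i x) L k = (\<Sum>i\<in>I. finite_fourier (h i) L k)" for L k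
    unfolding finite_fourier_eq
    by (simp only: sum_distrib_right sum_distrib_left[symmetric])
       (subst sum.swap, rule refl)
  then show ?thesis
    unfolding FFB_coeff_def by (simp only: sum_distrib_left) (rule sum.swap)
qed

lemma FFB_coeff_add: "FFB_coeff K (\<lambda>x. f x + g x) m n = FFB_coeff K f m n + FFB_coeff K g m n"
  unfolding FFB_coeff_def finite_fourier_eq
  by (simp add: distrib_right distrib_left sum.distrib)

lemma sum_norm_finite_fourier_square:
  assumes L: "L = 2 * K + 1"
  shows "(\<Sum>k\<in>freq_box K. (norm (finite_fourier g (L) k))\<^sup>2) =
    (2 / real (L))\<^sup>2 * 4 * (\<Sum>p\<in>{1..L} \<times> {1..L}.
      (norm (g (grid_point (L) (fst p), grid_point (L) (snd p))))\<^sup>2)"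
proof -
  have "L > 0" using L by simp
  let ?x = "\<lambda>p. (grid_point L (fst p), grid_point L (snd p))"
  let ?P = "{1..L} \<times> {1..L}"
  have orth: "(\<Sum>k\<in>freq_box K. cnj (wave k (?x p)) * cnj (cnj (wave k (?x q)))) =
      (if p = q then of_real (real (L * L)) else 0)" if "p \<in> ?P" "q \<in> ?P" for p q
  proof -
    have "(\<Sum>k\<in>freq_box K. cnj (wave k (?x p)) * cnj (cnj (wave k (?x q)))) =
      (\<Sum>k\<in>freq_box K. cis (pi * of_int (fst k) * (grid_point L (fst q) - grid_point L (fst p))) *
         cis (pi * of_int (snd k) * (grid_point L (snd q) - grid_point L (snd p))))"
      by (intro sum.cong refl) (simp add: wave_def cis_cnj cis_mult algebra_simps)
    also have "\<dots> = (\<Sum>k = - int K..int K. cis (pi * of_int k * (grid_point L (fst q) - grid_point L (fst p)))) *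
       (\<Sum>k = - int K..int K. cis (pi * of_int k * (grid_point L (snd q) - grid_point L (snd p))))"
      by (simp only: sum_product sum.cartesian_product' fst_conv snd_conv case_prod_unfold)
    also have "\<dots> = (if fst q = fst p then of_nat L else 0) * (if snd q = snd p then of_nat L else 0)"
    proof -
      have "fst q \<in> {1..L}" "fst p \<in> {1..L}" "snd q \<in> {1..L}" "snd p \<in> {1..L}"
        using that by auto
      then show ?thesis by (simp only: sum_cis_freq_orthogonal[OF L])
    qed
    also have "\<dots> = (if p = q then of_real (real (L * L)) else 0)"
      by (auto simp: prod_eq_iff)
    finally show ?thesis .
  qed
  have "(\<Sum>k\<in>freq_box K. (norm (finite_fourier g L k))\<^sup>2) =
     ((2 / real L)\<^sup>2)\<^sup>2 * (\<Sum>k\<in>freq_box K. (norm (\<Sum>p\<in>?P. g (?x p) * cnj (wave k (?x p))))\<^sup>2)"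
    unfolding finite_fourier_eq norm_mult power_mult_distrib norm_of_real power2_abs
    by (simp only: sum_distrib_left[symmetric])
  also have "(\<Sum>k\<in>freq_box K. (norm (\<Sum>p\<in>?P. g (?x p) * cnj (wave k (?x p))))\<^sup>2) =
     real (L * L) * (\<Sum>p\<in>?P. (norm (g (?x p)))\<^sup>2)"
    by (rule parseval_finite[where \<phi> = "\<lambda>p k. cnj (wave k (?x p))" and u = "\<lambda>p. g (?x p)"]) (simp, rule orth)
  also have "((2 / real L)\<^sup>2)\<^sup>2 * (real (L * L) * (\<Sum>p\<in>?P. (norm (g (?x p)))\<^sup>2)) =
     (2 / real L)\<^sup>2 * ((2 / real L)\<^sup>2 * real (L * L)) * (\<Sum>p\<in>?P. (norm (g (?x p)))\<^sup>2)"
    by (simp only: power2_eq_square mult_ac)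
  also have "(2 / real L)\<^sup>2 * real (L * L) = 4"
    using \<open>L > 0\<close> by (simp add: power2_eq_square)
  finally show ?thesis .
qed

lemma grid_point_in_interval:
  assumes "i \<in> {1..L}"
  shows "grid_point L i \<in> {-1..1}"
proof -
  have "L > 0" using assms by auto
  have "(real i - 1) * 2 \<le> 2 * real L" using assms by auto
  then have "(real i - 1) * (2 / real L) \<le> 2" using \<open>L > 0\<close> by (simp add: pos_divide_le_eq)
  moreover have "(real i - 1) * (2 / real L) \<ge> 0" using assms by auto
  ultimately show ?thesis by (simp add: grid_point_def)
qed

lemma norm_FFB_coeff_le:
  assumes C: "(\<Sum>k\<in>freq_box K. (norm (FFB_weight k m n))\<^sup>2) \<le> C\<^sup>2" "C \<ge> 0"
    and G: "G \<ge> 0" "\<And>x. x \<in> {-1..1} \<times> {-1..1} \<Longrightarrow> norm (g x) \<le> G"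
  shows "norm (FFB_coeff K g m n) \<le> 4 * C * G"
proof -
  define L where "L = 2 * K + 1"
  have "L > 0" by (simp add: L_def)
  have "(\<Sum>p\<in>{1..L} \<times> {1..L}. (norm (g (grid_point L (fst p), grid_point L (snd p))))\<^sup>2) \<le>
     (\<Sum>p\<in>{1..L} \<times> {1..L}. G\<^sup>2)"
    using grid_point_in_interval by (intro sum_mono power_mono G) (auto simp del: One_nat_def)
  also have "\<dots> = real L * real L * G\<^sup>2" by simp
  finally have "(\<Sum>k\<in>freq_box K. (norm (finite_fourier g L k))\<^sup>2) \<le>
      (2 / real L)\<^sup>2 * 4 * (real L * real L * G\<^sup>2)"
    unfolding sum_norm_finite_fourier_square[OF L_def] by (intro mult_left_mono) auto
  also have "\<dots> = (4 * G)\<^sup>2" using \<open>L > 0\<close> by (simp add: power2_eq_square)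
  finally have F: "(\<Sum>k\<in>freq_box K. (norm (finite_fourier g L k))\<^sup>2) \<le> (4 * G)\<^sup>2" .
  have "norm (FFB_coeff K g m n) \<le> (\<Sum>k\<in>freq_box K. norm (FFB_weight k m n) * norm (finite_fourier g L k))"
    unfolding FFB_coeff_def norm_mult[symmetric] L_def[symmetric] by (rule norm_sum)
  also have "\<dots> \<le> C * (4 * G)"
  proof (rule power2_le_imp_le)
    have "(\<Sum>k\<in>freq_box K. norm (FFB_weight k m n) * norm (finite_fourier g L k))\<^sup>2 \<le>
       (\<Sum>k\<in>freq_box K. (norm (FFB_weight k m n))\<^sup>2) * (\<Sum>k\<in>freq_box K. (norm (finite_fourier g L k))\<^sup>2)"
      by (rule Cauchy_Schwarz_ineq_sum)
    also have "\<dots> \<le> C\<^sup>2 * (4 * G)\<^sup>2"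
      using C F by (intro mult_mono sum_nonneg) auto
    finally show "(\<Sum>k\<in>freq_box K. norm (FFB_weight k m n) * norm (finite_fourier g L k))\<^sup>2 \<le> (C * (4 * G))\<^sup>2"
      by (simp only: power_mult_distrib)
  qed (use C G in simp)
  finally show ?thesis by simp
qed

section \<open>Approximation by trigonometric polynomials\<close>

lemma le_sin_half_pi:
  assumes "0 \<le> d" "d \<le> 1"
  shows "d \<le> sin (pi * d / 2)"
proof -
  have "convex_on {0..pi / 2} (\<lambda>x. - sin x)"
  proof (rule f''_ge0_imp_convex)
    show "((\<lambda>x. - sin x) has_real_derivative - cos x) (at x)" for x :: real
      by (auto intro!: derivative_eq_intros)
    show "((\<lambda>x. - cos x) has_real_derivative sin x) (at x)" for x :: real
      by (auto intro!: derivative_eq_intros)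
  qed (auto intro!: sin_ge_zero)
  from convex_onD_Icc'[OF this, of "pi * d / 2"] show ?thesis
    using assms by (simp add: field_simps)
qed

lemma min_le_abs_sin_half_pi:
  assumes "0 \<le> d" "d \<le> 2"
  shows "min d (2 - d) \<le> \<bar>sin (pi * d / 2)\<bar>"
proof (cases "d \<le> 1")
  case True
  then show ?thesis using le_sin_half_pi[OF assms(1)] by linarith
next
  case False
  then have "2 - d \<le> sin (pi * (2 - d) / 2)" using assms by (intro le_sin_half_pi) auto
  also have "pi * (2 - d) / 2 = pi - pi * d / 2" by (simp add: field_simps)
  finally show ?thesis by simp
qed

lemma periodic_lipschitz:
  fixes g :: "real \<Rightarrow> complex"
  assumes d: "\<And>t. t \<in> {-1..1} \<Longrightarrow> (g has_vector_derivative g' t) (at t)"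
    and B: "\<And>t. t \<in> {-1..1} \<Longrightarrow> norm (g' t) \<le> B"
    and g0: "g (-1) = 0" "g 1 = 0"
    and st: "s \<in> {-1..1}" "t \<in> {-1..1}"
  shows "norm (g s - g t) \<le> B * \<bar>sin (pi * (s - t) / 2)\<bar>"
proof -
  have B0: "B \<ge> 0" using B[of 0] norm_ge_zero[of "g' 0"] by (simp del: norm_ge_zero)
  have lip: "norm (g x - g y) \<le> B * \<bar>x - y\<bar>" if "x \<in> {-1..1}" "y \<in> {-1..1}" for x y
  proof -
    have "norm (g x - g y) \<le> B * norm (x - y)"
    proof (rule differentiable_bound[of "{-1..1}" g "\<lambda>u h. h *\<^sub>R g' u"])
      fix u :: real assume u: "u \<in> {-1..1}"
      show "(g has_derivative (\<lambda>h. h *\<^sub>R g' u)) (at u within {-1..1})"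
        using d[OF u] by (simp add: has_vector_derivative_def has_derivative_at_withinI)
      show "onorm (\<lambda>h. h *\<^sub>R g' u) \<le> B"
        using B[OF u] B0 by (intro onorm_bound) (auto simp: mult.commute[of B] intro: mult_left_mono)
    qed (use that in auto)
    then show ?thesis by simp
  qed
  have main: "norm (g s - g t) \<le> B * \<bar>sin (pi * (s - t) / 2)\<bar>"
    if "s \<in> {-1..1}" "t \<in> {-1..1}" "t \<le> s" for s t
  proof -
    have "norm (g s - g t) \<le> norm (g s - g 1) + norm (g t - g (-1))"
      using norm_triangle_ineq4[of "g s" "g t"] by (simp add: g0)
    also have "\<dots> \<le> B * \<bar>s - 1\<bar> + B * \<bar>t - (-1)\<bar>"
      using that by (intro add_mono lip) auto
    also have "\<dots> = B * (2 - (s - t))" using that by (simp add: algebra_simps)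
    finally have "norm (g s - g t) \<le> B * (2 - (s - t))" .
    moreover have "norm (g s - g t) \<le> B * (s - t)" using lip[of s t] that by simp
    ultimately have "norm (g s - g t) \<le> B * min (s - t) (2 - (s - t))" by (simp add: min_def)
    also have "\<dots> \<le> B * \<bar>sin (pi * (s - t) / 2)\<bar>"
      using that B0 by (intro mult_left_mono min_le_abs_sin_half_pi) auto
    finally show ?thesis .
  qed
  show ?thesis
  proof (cases "t \<le> s")
    case True
    then show ?thesis using main st by simp
  next
    case False
    have "pi * (t - s) / 2 = - (pi * (s - t) / 2)" by (simp add: field_simps)
    then have "\<bar>sin (pi * (t - s) / 2)\<bar> = \<bar>sin (pi * (s - t) / 2)\<bar>" by (simp only: sin_minus abs_minus)
    then show ?thesis using main[of t s] st False by (simp add: norm_minus_commute)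
  qed
qed

lemma C_class_continuous: "C_class q f \<Longrightarrow> continuous_on UNIV f"
  by (cases q) auto

lemma C_class_partial:
  assumes "C_class (Suc q) f" "b \<in> Basis"
  obtains D where "continuous_on UNIV D"
    "\<And>x s. ((\<lambda>t. f (x + t *\<^sub>R b)) has_vector_derivative D (x + s *\<^sub>R b)) (at s)"
proof
  let ?D = "\<lambda>x. vector_derivative (\<lambda>t::real. f (x + t *\<^sub>R b)) (at 0)"
  show "continuous_on UNIV ?D"
    using assms C_class_continuous[of q ?D] by simp
  fix x s
  have "((\<lambda>t. f ((x + s *\<^sub>R b) + t *\<^sub>R b)) has_vector_derivative ?D (x + s *\<^sub>R b)) (at (s - s))"
    using assms by (auto simp: vector_derivative_works)
  moreover have "((\<lambda>t. t - s) has_vector_derivative 1) (at s)"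
    by (auto intro!: derivative_eq_intros)
  ultimately have "((\<lambda>t. f ((x + s *\<^sub>R b) + t *\<^sub>R b)) \<circ> (\<lambda>t. t - s) has_vector_derivative 1 *\<^sub>R ?D (x + s *\<^sub>R b)) (at s)"
    by (intro vector_diff_chain_at)
  moreover have "(\<lambda>t. f ((x + s *\<^sub>R b) + t *\<^sub>R b)) \<circ> (\<lambda>t. t - s) = (\<lambda>t. f (x + t *\<^sub>R b))"
    by (auto simp: fun_eq_iff algebra_simps)
  ultimately show "((\<lambda>t. f (x + t *\<^sub>R b)) has_vector_derivative ?D (x + s *\<^sub>R b)) (at s)" by simp
qed

lemma C_class_periodic_lipschitz:
  fixes f :: "real \<times> real \<Rightarrow> complex"
  assumes "C_class (Suc q) f" and supp: "supp f \<subseteq> ball 0 1"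
  shows "\<exists>B\<ge>0. \<forall>x\<in>{-1..1} \<times> {-1..1}. \<forall>y\<in>{-1..1} \<times> {-1..1}. norm (f x - f y) \<le>
    B * (\<bar>sin (pi * (fst x - fst y) / 2)\<bar> + \<bar>sin (pi * (snd x - snd y) / 2)\<bar>)"
proof -
  let ?Q = "{-1..1} \<times> {-1..1} :: (real \<times> real) set"
  have zero: "f x = 0" if "norm x \<ge> 1" for x
    using supp that by (auto simp: supp_def)
  have zero': "f (s, y) = 0" "f (y, s) = 0" if "\<bar>s\<bar> = 1" for s y
    using that norm_fst_le[of s y] norm_snd_le[of s y] by (auto intro!: zero)
  have Basis: "((1, 0) :: real \<times> real) \<in> Basis" "((0, 1) :: real \<times> real) \<in> Basis"
    by (auto simp: Basis_prod_def)
  obtain D1 where D1: "continuous_on UNIV D1"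
    "\<And>x s. ((\<lambda>t. f (x + t *\<^sub>R (1, 0))) has_vector_derivative D1 (x + s *\<^sub>R (1, 0))) (at s)"
    by (rule C_class_partial[OF assms(1) Basis(1)]) blast
  obtain D2 where D2: "continuous_on UNIV D2"
    "\<And>x s. ((\<lambda>t. f (x + t *\<^sub>R (0, 1))) has_vector_derivative D2 (x + s *\<^sub>R (0, 1))) (at s)"
    by (rule C_class_partial[OF assms(1) Basis(2)]) blast
  have bdd: "\<exists>B. \<forall>x\<in>?Q. norm (D x) \<le> B" if "continuous_on UNIV D" for D :: "real \<times> real \<Rightarrow> complex"
  proof -
    have "compact (D ` ?Q)"
      by (intro compact_continuous_image compact_Times compact_Icc continuous_on_subset[OF that]) auto
    then have "bounded (D ` ?Q)" by (rule compact_imp_bounded)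
    then show ?thesis by (auto simp: bounded_iff)
  qed
  from bdd[OF D1(1)] obtain B1 where B1: "\<And>x. x \<in> ?Q \<Longrightarrow> norm (D1 x) \<le> B1" by blast
  from bdd[OF D2(1)] obtain B2 where B2: "\<And>x. x \<in> ?Q \<Longrightarrow> norm (D2 x) \<le> B2" by blast
  define B where "B = max 0 (max B1 B2)"
  have "norm (f x - f y) \<le> B * (\<bar>sin (pi * (fst x - fst y) / 2)\<bar> + \<bar>sin (pi * (snd x - snd y) / 2)\<bar>)"
    if "x \<in> ?Q" "y \<in> ?Q" for x y
  proof -
    obtain x1 x2 y1 y2 where xy: "x = (x1, x2)" "y = (y1, y2)" by force
    have in_Q: "x1 \<in> {-1..1}" "x2 \<in> {-1..1}" "y1 \<in> {-1..1}" "y2 \<in> {-1..1}" using that by (auto simp: xy)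
    have "norm (f (x1, x2) - f (y1, x2)) \<le> B * \<bar>sin (pi * (x1 - y1) / 2)\<bar>"
    proof (rule periodic_lipschitz[where g = "\<lambda>t. f (t, x2)" and g' = "\<lambda>t. D1 (t, x2)"])
      fix t :: real assume "t \<in> {-1..1}"
      then show "norm (D1 (t, x2)) \<le> B" using B1[of "(t, x2)"] in_Q by (auto simp: B_def)
      show "((\<lambda>t. f (t, x2)) has_vector_derivative D1 (t, x2)) (at t)"
        using D1(2)[of "(0, x2)" t] by simp
    qed (use in_Q zero' in auto)
    moreover have "norm (f (y1, x2) - f (y1, y2)) \<le> B * \<bar>sin (pi * (x2 - y2) / 2)\<bar>"
    proof (rule periodic_lipschitz[where g = "\<lambda>t. f (y1, t)" and g' = "\<lambda>t. D2 (y1, t)"])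
      fix t :: real assume "t \<in> {-1..1}"
      then show "norm (D2 (y1, t)) \<le> B" using B2[of "(y1, t)"] in_Q by (auto simp: B_def)
      show "((\<lambda>t. f (y1, t)) has_vector_derivative D2 (y1, t)) (at t)"
        using D2(2)[of "(y1, 0)" t] by simp
    qed (use in_Q zero' in auto)
    ultimately have "norm ((f (x1, x2) - f (y1, x2)) + (f (y1, x2) - f (y1, y2))) \<le>
        B * \<bar>sin (pi * (x1 - y1) / 2)\<bar> + B * \<bar>sin (pi * (x2 - y2) / 2)\<bar>"
      by (intro norm_triangle_mono)
    then show ?thesis by (simp add: xy algebra_simps)
  qed
  moreover have "B \<ge> 0" by (simp add: B_def)
  ultimately show ?thesis by blast
qed

text \<open>\<open>|fk_poly K|\<^sup>2\<close> is the Fejer-Korovkin kernel; the sine coefficients satisfy the Dirichlet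
  three-term recurrence, which makes the second moment \<open>(1 - cos (\<pi> / (K + 2))) / 2\<close> exact.\<close>

definition fk_poly :: "nat \<Rightarrow> real \<Rightarrow> complex" where
  "fk_poly K t = (\<Sum>j = 1..K + 1. of_real (sin (pi / real (K + 2) * real j)) * cis (pi * real j * t))"

definition fk_mass :: "nat \<Rightarrow> real" where
  "fk_mass K = (\<Sum>j = 1..K + 1. (sin (pi / real (K + 2) * real j))\<^sup>2)"

definition fk_weight :: "nat \<Rightarrow> real \<Rightarrow> nat \<Rightarrow> real" where
  "fk_weight K x i = (norm (fk_poly K (x - grid_point (2 * K + 1) i)))\<^sup>2 / (real (2 * K + 1) * fk_mass K)"

lemma fk_mass_pos: "fk_mass K > 0"
proof -
  have "sin (pi / real (K + 2) * real 1) > 0"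
    by (intro sin_gt_zero) (auto simp: field_simps add_pos_nonneg)
  then have "0 < (sin (pi / real (K + 2) * real 1))\<^sup>2" by simp
  also have "\<dots> \<le> fk_mass K"
    unfolding fk_mass_def by (rule member_le_sum) auto
  finally show ?thesis .
qed

lemma sum_grid_trig_poly_square:
  assumes "n \<le> L"
  shows "(\<Sum>i = 1..L. (norm (\<Sum>j = 1..n. u j * cis (pi * real j * (x - grid_point L i))))\<^sup>2) =
    real L * (\<Sum>j = 1..n. (norm (u j))\<^sup>2)"
proof (rule parseval_finite)
  fix a a' assume a: "a \<in> {1..n}" "a' \<in> {1..n}"
  have "(\<Sum>i = 1..L. cis (pi * real a * (x - grid_point L i)) * cnj (cis (pi * real a' * (x - grid_point L i)))) =
     cis (pi * (real a - real a') * x) * (\<Sum>i = 1..L. cis (pi * of_int (int a' - int a) * grid_point L i))"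
    unfolding sum_distrib_left
    by (intro sum.cong refl) (simp add: cis_cnj cis_mult algebra_simps)
  also have "\<bar>int a' - int a\<bar> < int L" using a assms by auto
  then have "(\<Sum>i = 1..L. cis (pi * of_int (int a' - int a) * grid_point L i)) = (if int a' - int a = 0 then of_nat L else 0)"
    by (rule sum_cis_grid_orthogonal)
  finally show "(\<Sum>i = 1..L. cis (pi * real a * (x - grid_point L i)) * cnj (cis (pi * real a' * (x - grid_point L i)))) =
     (if a = a' then of_real (real L) else 0)"
    by auto
qed simp

lemma sum_sin_diff_square:
  "(\<Sum>j = 1..Suc n. (sin (\<alpha> * real j) - sin (\<alpha> * real (j - 1)))\<^sup>2) =
    2 * (1 - cos \<alpha>) * (\<Sum>j = 1..n. (sin (\<alpha> * real j))\<^sup>2) +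
      (sin (\<alpha> * real (Suc n)))\<^sup>2 - sin (\<alpha> * real (Suc n)) * sin (\<alpha> * real n)"
proof (induction n)
  case 0
  then show ?case by simp
next
  case (Suc n)
  define p where "p = sin (\<alpha> * real n)"
  define q where "q = sin (\<alpha> * real (Suc n))"
  define r where "r = sin (\<alpha> * real (Suc (Suc n)))"
  define c where "c = cos \<alpha>"
  have "p = sin (\<alpha> * real (Suc n) - \<alpha>)" "r = sin (\<alpha> * real (Suc n) + \<alpha>)"
    by (simp_all add: p_def r_def algebra_simps)
  then have rec: "r + p = 2 * c * q"
    by (simp add: sin_diff sin_add c_def q_def)
  have "(\<Sum>j = 1..Suc (Suc n). (sin (\<alpha> * real j) - sin (\<alpha> * real (j - 1)))\<^sup>2) =
      (\<Sum>j = 1..Suc n. (sin (\<alpha> * real j) - sin (\<alpha> * real (j - 1)))\<^sup>2) + (r - q)\<^sup>2"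
    by (subst sum.cl_ivl_Suc) (simp add: r_def q_def)
  also have "\<dots> = 2 * (1 - c) * (\<Sum>j = 1..n. (sin (\<alpha> * real j))\<^sup>2) + q\<^sup>2 - q * p + (r - q)\<^sup>2"
    unfolding Suc.IH p_def q_def c_def by simp
  also have "p = 2 * c * q - r" using rec by simp
  also have "2 * (1 - c) * (\<Sum>j = 1..n. (sin (\<alpha> * real j))\<^sup>2) + q\<^sup>2 - q * (2 * c * q - r) + (r - q)\<^sup>2 =
      2 * (1 - c) * ((\<Sum>j = 1..n. (sin (\<alpha> * real j))\<^sup>2) + q\<^sup>2) + r\<^sup>2 - r * q"
    by (simp add: algebra_simps power2_eq_square)
  also have "(\<Sum>j = 1..n. (sin (\<alpha> * real j))\<^sup>2) + q\<^sup>2 = (\<Sum>j = 1..Suc n. (sin (\<alpha> * real j))\<^sup>2)"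
    by (simp add: q_def)
  finally show ?case by (simp only: r_def q_def c_def)
qed

lemma fk_poly_times:
  "(1 - cis (pi * t)) * fk_poly K t =
    (\<Sum>j = 1..K + 2. of_real (sin (pi / real (K + 2) * real j) - sin (pi / real (K + 2) * real (j - 1))) * cis (pi * real j * t))"
proof -
  define w where "w j = complex_of_real (sin (pi / real (K + 2) * real j))" for j
  have w0: "w 0 = 0" and w1: "w (K + 2) = 0" by (simp_all add: w_def)
  have "(\<Sum>j = 1..K + 2. (w j - w (j - 1)) * cis (pi * real j * t)) =
      (\<Sum>j = 1..K + 2. w j * cis (pi * real j * t)) - (\<Sum>j = 1..K + 2. w (j - 1) * cis (pi * real j * t))"
    by (simp add: algebra_simps sum_subtractf)
  also have "(\<Sum>j = 1..K + 2. w j * cis (pi * real j * t)) = fk_poly K t"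
    using w1 by (simp add: fk_poly_def w_def)
  also have "(\<Sum>j = 1..K + 2. w (j - 1) * cis (pi * real j * t)) =
      (\<Sum>j = 0..K + 1. w j * cis (pi * real (Suc j) * t))"
    by (rule sum.reindex_bij_witness[of _ Suc "\<lambda>j. j - 1"]) auto
  also have "\<dots> = (\<Sum>j = 1..K + 1. w j * cis (pi * real (Suc j) * t))"
    by (subst sum.atLeast_Suc_atMost) (simp_all add: w0)
  also have "\<dots> = cis (pi * t) * fk_poly K t"
    unfolding fk_poly_def sum_distrib_left w_def[symmetric]
    by (intro sum.cong refl) (simp add: cis_mult algebra_simps)
  finally show ?thesis by (simp add: w_def algebra_simps)
qed

lemma norm_one_minus_cis_square: "(norm (1 - cis (pi * t)))\<^sup>2 = 4 * (sin (pi * t / 2))\<^sup>2"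
proof -
  have "(norm (1 - cis (pi * t)))\<^sup>2 = (1 - cos (pi * t))\<^sup>2 + (sin (pi * t))\<^sup>2"
    by (simp add: cmod_power2)
  also have "\<dots> = 2 - 2 * cos (pi * t)"
    using sin_cos_squared_add[of "pi * t"] by (simp add: power2_diff)
  also have "cos (pi * t) = 1 - 2 * (sin (pi * t / 2))\<^sup>2"
    using cos_double_sin[of "pi * t / 2"] by simp
  finally show ?thesis by simp
qed

lemma fk_weight_nonneg: "fk_weight K x i \<ge> 0"
  using fk_mass_pos[of K] by (simp add: fk_weight_def)

lemma sum_fk_weight: "(\<Sum>i = 1..2 * K + 1. fk_weight K x i) = 1"
proof -
  define L where "L = 2 * K + 1"
  have "(\<Sum>i = 1..L. (norm (fk_poly K (x - grid_point L i)))\<^sup>2) = real L * fk_mass K"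
    unfolding fk_poly_def fk_mass_def
    by (subst sum_grid_trig_poly_square) (auto simp: L_def)
  moreover have "real L * fk_mass K \<noteq> 0" using fk_mass_pos[of K] by (simp add: L_def)
  ultimately show ?thesis
    unfolding fk_weight_def L_def[symmetric] sum_divide_distrib[symmetric] by simp
qed

lemma sum_fk_weight_sin_square:
  assumes "K \<ge> 1"
  shows "(\<Sum>i = 1..2 * K + 1. fk_weight K x i * (sin (pi * (x - grid_point (2 * K + 1) i) / 2))\<^sup>2) \<le> (pi / real (K + 2))\<^sup>2 / 4"
proof -
  define L where "L = 2 * K + 1"
  define \<alpha> where "\<alpha> = pi / real (K + 2)"
  define w where "w j = sin (\<alpha> * real j) - sin (\<alpha> * real (j - 1))" for j
  let ?t = "\<lambda>i. x - grid_point L i"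
  have "4 * (\<Sum>i = 1..L. (norm (fk_poly K (?t i)))\<^sup>2 * (sin (pi * ?t i / 2))\<^sup>2) =
      (\<Sum>i = 1..L. (norm ((1 - cis (pi * ?t i)) * fk_poly K (?t i)))\<^sup>2)"
    unfolding norm_mult power_mult_distrib norm_one_minus_cis_square sum_distrib_left
    by (intro sum.cong refl) simp
  also have "\<dots> = (\<Sum>i = 1..L. (norm (\<Sum>j = 1..K + 2. of_real (w j) * cis (pi * real j * ?t i)))\<^sup>2)"
    unfolding fk_poly_times w_def \<alpha>_def by (rule refl)
  also have "\<dots> = real L * (\<Sum>j = 1..K + 2. (w j)\<^sup>2)"
    using assms by (subst sum_grid_trig_poly_square) (auto simp: L_def)
  also have "(\<Sum>j = 1..K + 2. (w j)\<^sup>2) = 2 * (1 - cos \<alpha>) * fk_mass K"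
  proof -
    have "(\<Sum>j = 1..Suc (K + 1). (w j)\<^sup>2) = 2 * (1 - cos \<alpha>) * fk_mass K"
      unfolding w_def sum_sin_diff_square by (simp add: fk_mass_def \<alpha>_def)
    then show ?thesis by simp
  qed
  finally have "(\<Sum>i = 1..L. (norm (fk_poly K (?t i)))\<^sup>2 * (sin (pi * ?t i / 2))\<^sup>2) = 
      (real L * fk_mass K) * ((1 - cos \<alpha>) / 2)"
    by (simp add: algebra_simps)
  moreover have "c * b / c = b" if "c \<noteq> 0" for b c :: real using that by simp
  moreover have "real L * fk_mass K \<noteq> 0" using fk_mass_pos[of K] by (simp add: L_def)
  ultimately have "(\<Sum>i = 1..L. fk_weight K x i * (sin (pi * ?t i / 2))\<^sup>2) = (1 - cos \<alpha>) / 2"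
    unfolding fk_weight_def L_def[symmetric] times_divide_eq_left sum_divide_distrib[symmetric]
    by metis
  also have "\<dots> = (sin (\<alpha> / 2))\<^sup>2" using cos_double_sin[of "\<alpha> / 2"] by simp
  also have "\<dots> \<le> (\<alpha> / 2)\<^sup>2"
    using abs_sin_x_le_abs_x[of "\<alpha> / 2"] by (simp only: abs_le_square_iff)
  also have "\<dots> = (pi / real (K + 2))\<^sup>2 / 4" unfolding \<alpha>_def by (subst power_divide) simp
  finally show ?thesis by (simp only: L_def)
qed

lemma sum_fk_weight_abs_sin:
  assumes "K \<ge> 1"
  shows "(\<Sum>i = 1..2 * K + 1. fk_weight K x i * \<bar>sin (pi * (x - grid_point (2 * K + 1) i) / 2)\<bar>) \<le> pi / (2 * real K)"
proof -
  define L where "L = 2 * K + 1"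
  define h where "h = pi / real (K + 2) / 2"
  have h: "h > 0" by (simp add: h_def)
  let ?s = "\<lambda>i. sin (pi * (x - grid_point L i) / 2)"
  \<comment> \<open>AM-GM: \<open>\<bar>s\<bar> \<le> (h + s\<^sup>2 / h) / 2\<close>\<close>
  have amgm: "\<bar>s\<bar> \<le> h / 2 + s\<^sup>2 / (2 * h)" for s
  proof -
    have "0 \<le> (h - \<bar>s\<bar>)\<^sup>2" by simp
    then have "2 * h * \<bar>s\<bar> \<le> h\<^sup>2 + s\<^sup>2" by (simp add: power2_diff)
    then show ?thesis using h by (simp add: field_simps power2_eq_square)
  qed
  have "(\<Sum>i = 1..L. fk_weight K x i * \<bar>?s i\<bar>) \<le> (\<Sum>i = 1..L. fk_weight K x i * (h / 2 + (?s i)\<^sup>2 / (2 * h)))"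
    by (intro sum_mono mult_left_mono amgm fk_weight_nonneg)
  also have "\<dots> = h / 2 * (\<Sum>i = 1..L. fk_weight K x i) + (\<Sum>i = 1..L. fk_weight K x i * (?s i)\<^sup>2) / (2 * h)"
    by (simp add: distrib_left sum.distrib sum_distrib_left sum_divide_distrib mult_ac)
  also have "(\<Sum>i = 1..L. fk_weight K x i) = 1" unfolding L_def by (rule sum_fk_weight)
  also have "h / 2 * 1 + (\<Sum>i = 1..L. fk_weight K x i * (?s i)\<^sup>2) / (2 * h) \<le> h / 2 * 1 + h\<^sup>2 / (2 * h)"
  proof -
    have "h\<^sup>2 = (pi / real (K + 2))\<^sup>2 / 4" unfolding h_def by (subst power_divide) simp
    then have "(\<Sum>i = 1..L. fk_weight K x i * (?s i)\<^sup>2) \<le> h\<^sup>2"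
      using sum_fk_weight_sin_square[OF assms, of x] by (simp only: L_def)
    then show ?thesis using h by (intro add_mono order_refl divide_right_mono) auto
  qed
  also have "\<dots> = h" using h by (simp add: power2_eq_square)
  also have "h \<le> pi / (2 * real K)" using assms by (simp add: h_def field_simps)
  finally show ?thesis by (simp only: L_def)
qed

definition FFB_exact :: "nat \<Rightarrow> int \<Rightarrow> nat \<Rightarrow> (real \<times> real \<Rightarrow> complex) \<Rightarrow> bool" where
  "FFB_exact K m n g \<longleftrightarrow> continuous_on UNIV g \<and> FFB_coeff K g m n = FB_coeff g m n"

lemma FFB_exact_wave: "n \<ge> 1 \<Longrightarrow> k \<in> freq_box K \<Longrightarrow> FFB_exact K m n (wave k)"
  by (simp add: FFB_exact_def FB_coeff_wave FFB_coeff_wave continuous_on_wave)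

lemma FFB_exact_mult: "FFB_exact K m n g \<Longrightarrow> FFB_exact K m n (\<lambda>x. c * g x)"
  by (auto simp: FFB_exact_def FFB_coeff_mult FB_coeff_mult intro!: continuous_intros)

lemma FFB_exact_sum:
  "finite I \<Longrightarrow> (\<And>i. i \<in> I \<Longrightarrow> FFB_exact K m n (h i)) \<Longrightarrow> FFB_exact K m n (\<lambda>x. \<Sum>i\<in>I. h i x)"
  by (auto simp: FFB_exact_def FFB_coeff_sum FB_coeff_sum intro!: continuous_intros)

lemma norm_fk_poly_square:
  "of_real ((norm (fk_poly K t))\<^sup>2) = (\<Sum>p\<in>{1..K + 1} \<times> {1..K + 1}.
     of_real (sin (pi / real (K + 2) * real (fst p)) * sin (pi / real (K + 2) * real (snd p))) *
       cis (pi * of_int (int (fst p) - int (snd p)) * t))"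
proof -
  have "of_real ((norm (fk_poly K t))\<^sup>2) = fk_poly K t * cnj (fk_poly K t)"
    by (rule complex_norm_square)
  also have "\<dots> = (\<Sum>p\<in>{1..K + 1} \<times> {1..K + 1}.
     (of_real (sin (pi / real (K + 2) * real (fst p))) * cis (pi * real (fst p) * t)) *
     cnj (of_real (sin (pi / real (K + 2) * real (snd p))) * cis (pi * real (snd p) * t)))"
    unfolding fk_poly_def cnj_sum
    by (simp only: sum_product sum.cartesian_product case_prod_unfold)
  also have "\<dots> = (\<Sum>p\<in>{1..K + 1} \<times> {1..K + 1}.
     of_real (sin (pi / real (K + 2) * real (fst p)) * sin (pi / real (K + 2) * real (snd p))) *
       cis (pi * of_int (int (fst p) - int (snd p)) * t))"
  proof (intro sum.cong refl)
    fix p :: "nat \<times> nat"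
    have "cis (pi * of_int (int (fst p) - int (snd p)) * t) = cis (pi * real (fst p) * t) * cnj (cis (pi * real (snd p) * t))"
      by (simp add: cis_cnj cis_mult algebra_simps)
    then show "(of_real (sin (pi / real (K + 2) * real (fst p))) * cis (pi * real (fst p) * t)) *
       cnj (of_real (sin (pi / real (K + 2) * real (snd p))) * cis (pi * real (snd p) * t)) =
       of_real (sin (pi / real (K + 2) * real (fst p)) * sin (pi / real (K + 2) * real (snd p))) *
         cis (pi * of_int (int (fst p) - int (snd p)) * t)"
      by simp
  qed
  finally show ?thesis .
qed

lemma FFB_exact_fk_weight:
  assumes "n \<ge> 1"
  shows "FFB_exact K m n (\<lambda>x. of_real (fk_weight K (fst x) i * fk_weight K (snd x) j))"
proof -
  define a where "a = grid_point (2 * K + 1) i"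
  define b where "b = grid_point (2 * K + 1) j"
  define c where "c = 1 / (real (2 * K + 1) * fk_mass K)"
  define w where "w p = complex_of_real (sin (pi / real (K + 2) * real (fst p)) * sin (pi / real (K + 2) * real (snd p)))"
    for p :: "nat \<times> nat"
  define d where "d p = int (fst p) - int (snd p)" for p :: "nat \<times> nat"
  let ?I = "{1..K + 1} \<times> {1..K + 1}"
  have "of_real (fk_weight K (fst x) i * fk_weight K (snd x) j) =
    (\<Sum>p\<in>?I. \<Sum>q\<in>?I. (of_real (c * c) * w p * w q * cis (- pi * (of_int (d p) * a + of_int (d q) * b))) * wave (d p, d q) x)"
    for x
  proof -
    have "of_real (fk_weight K (fst x) i * fk_weight K (snd x) j) =
      complex_of_real (c * c) * (of_real ((norm (fk_poly K (fst x - a)))\<^sup>2) * of_real ((norm (fk_poly K (snd x - b)))\<^sup>2))"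
      by (simp add: fk_weight_def a_def b_def c_def)
    also have "\<dots> = of_real (c * c) * (\<Sum>p\<in>?I. \<Sum>q\<in>?I.
       (w p * cis (pi * of_int (d p) * (fst x - a))) * (w q * cis (pi * of_int (d q) * (snd x - b))))"
      unfolding norm_fk_poly_square w_def d_def by (simp only: sum_product)
    also have "\<dots> = (\<Sum>p\<in>?I. \<Sum>q\<in>?I. (of_real (c * c) * w p * w q * cis (- pi * (of_int (d p) * a + of_int (d q) * b))) * wave (d p, d q) x)"
      unfolding sum_distrib_left
    proof (intro sum.cong refl)
      fix p q
      have "cis (pi * of_int (d p) * (fst x - a)) * cis (pi * of_int (d q) * (snd x - b)) =
         cis (- pi * (of_int (d p) * a + of_int (d q) * b)) * wave (d p, d q) x"
        unfolding wave_def cis_mult by (rule arg_cong[of _ _ cis]) (simp add: algebra_simps)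
      then show "of_real (c * c) * ((w p * cis (pi * of_int (d p) * (fst x - a))) * (w q * cis (pi * of_int (d q) * (snd x - b)))) =
        (of_real (c * c) * w p * w q * cis (- pi * (of_int (d p) * a + of_int (d q) * b))) * wave (d p, d q) x"
        by (simp only: mult_ac) 
    qed
    finally show ?thesis .
  qed
  moreover have "FFB_exact K m n (\<lambda>x. \<Sum>p\<in>?I. \<Sum>q\<in>?I.
      (of_real (c * c) * w p * w q * cis (- pi * (of_int (d p) * a + of_int (d q) * b))) * wave (d p, d q) x)"
    by (intro FFB_exact_sum FFB_exact_mult FFB_exact_wave assms) (auto simp: d_def)
  ultimately show ?thesis by simp
qed

lemma FFB_coeff_error:
  fixes f :: "real \<times> real \<Rightarrow> complex"
  assumes "C_class 2 f" "supp f \<subseteq> ball 0 1" "n \<ge> 1"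
  shows "\<exists>A\<ge>0. \<forall>K\<ge>1. norm (FFB_coeff K f m n - FB_coeff f m n) \<le> A / real K"
proof -
  let ?Q = "{-1..1} \<times> {-1..1} :: (real \<times> real) set"
  have cont: "continuous_on UNIV f" using assms(1) by (rule C_class_continuous)
  have "C_class (Suc 1) f" using assms(1) by (simp only: numeral_2_eq_2 One_nat_def)
  from C_class_periodic_lipschitz[OF this assms(2)]
  obtain B where B: "B \<ge> 0" "\<And>x y. x \<in> ?Q \<Longrightarrow> y \<in> ?Q \<Longrightarrow> norm (f x - f y) \<le>
    B * (\<bar>sin (pi * (fst x - fst y) / 2)\<bar> + \<bar>sin (pi * (snd x - snd y) / 2)\<bar>)" by blast
  obtain C where C: "C \<ge> 0" "\<And>K. (\<Sum>k\<in>freq_box K. (norm (FFB_weight k m n))\<^sup>2) \<le> C\<^sup>2"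
    using sum_FFB_weight_square_bound[OF assms(3)] by blast
  define D where "D = 2 * pi / (sqrt pi * \<bar>bessel_J (m + 1) (bessel_zero m n)\<bar>)"
  have D: "D \<ge> 0" by (simp add: D_def)
  have "norm (FFB_coeff K f m n - FB_coeff f m n) \<le> (4 * C + D) * (B * pi) / real K" if K: "K \<ge> 1" for K
  proof -
    define L where "L = 2 * K + 1"
    let ?P = "{1..L} \<times> {1..L}"
    define x where "x p = (grid_point L (fst p), grid_point L (snd p))" for p
    define \<mu> where "\<mu> y p = fk_weight K (fst y) (fst p) * fk_weight K (snd y) (snd p)" for y p
    define q where "q y = (\<Sum>p\<in>?P. f (x p) * of_real (\<mu> y p))" for y
    define g where "g y = f y - q y" for y
    define G where "G = B * pi / real K"
    have G: "G \<ge> 0" using B by (simp add: G_def)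
    have exact: "FFB_exact K m n q"
      unfolding q_def[abs_def] \<mu>_def
      by (intro FFB_exact_sum FFB_exact_mult FFB_exact_fk_weight assms(3)) auto
    then have cont_q: "continuous_on UNIV q" by (simp add: FFB_exact_def)
    have xQ: "x p \<in> ?Q" if "p \<in> ?P" for p
      using that grid_point_in_interval[of "fst p" L] grid_point_in_interval[of "snd p" L] by (auto simp: x_def)
    have sum_1: "(\<Sum>i = 1..L. fk_weight K z i) = 1" for z
      unfolding L_def by (rule sum_fk_weight)
    have sum_s: "(\<Sum>i = 1..L. fk_weight K z i * \<bar>sin (pi * (z - grid_point L i) / 2)\<bar>) \<le> pi / (2 * real K)" for z
      unfolding L_def by (rule sum_fk_weight_abs_sin[OF K])
    have approx: "norm (g y) \<le> G" if y: "y \<in> ?Q" for y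
    proof -
      let ?s1 = "\<lambda>i. \<bar>sin (pi * (fst y - grid_point L i) / 2)\<bar>"
      let ?s2 = "\<lambda>i. \<bar>sin (pi * (snd y - grid_point L i) / 2)\<bar>"
      have \<mu>_sum: "(\<Sum>p\<in>?P. \<mu> y p) = (\<Sum>i = 1..L. fk_weight K (fst y) i) * (\<Sum>i = 1..L. fk_weight K (snd y) i)"
        unfolding \<mu>_def by (simp only: sum_product sum.cartesian_product case_prod_unfold)
      have "g y = f y * of_real (\<Sum>p\<in>?P. \<mu> y p) - q y"
        by (simp only: g_def \<mu>_sum sum_1 mult_1 mult_1_right of_real_1)
      also have "\<dots> = (\<Sum>p\<in>?P. (f y - f (x p)) * of_real (\<mu> y p))"
        by (simp add: q_def sum_distrib_left left_diff_distrib sum_subtractf)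
      also have "norm \<dots> \<le> (\<Sum>p\<in>?P. B * (?s1 (fst p) + ?s2 (snd p)) * \<mu> y p)"
      proof (intro sum_norm_le)
        fix p assume p: "p \<in> ?P"
        have "\<mu> y p \<ge> 0" by (simp add: \<mu>_def fk_weight_nonneg)
        then show "norm ((f y - f (x p)) * of_real (\<mu> y p)) \<le> B * (?s1 (fst p) + ?s2 (snd p)) * \<mu> y p"
          using B(2)[OF y xQ[OF p]] by (simp add: norm_mult mult_right_mono x_def)
      qed
      also have "\<dots> = B * ((\<Sum>p\<in>?P. (fk_weight K (fst y) (fst p) * ?s1 (fst p)) * fk_weight K (snd y) (snd p)) +
          (\<Sum>p\<in>?P. fk_weight K (fst y) (fst p) * (fk_weight K (snd y) (snd p) * ?s2 (snd p))))"
        unfolding sum.distrib[symmetric] sum_distrib_left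
        by (intro sum.cong refl) (simp add: \<mu>_def algebra_simps)
      also have "\<dots> = B * ((\<Sum>i = 1..L. fk_weight K (fst y) i * ?s1 i) * (\<Sum>i = 1..L. fk_weight K (snd y) i) +
          (\<Sum>i = 1..L. fk_weight K (fst y) i) * (\<Sum>i = 1..L. fk_weight K (snd y) i * ?s2 i))"
        by (simp only: sum_product sum.cartesian_product case_prod_unfold)
      also have "\<dots> \<le> B * (pi / (2 * real K) * 1 + 1 * (pi / (2 * real K)))"
        unfolding sum_1 using B(1) sum_s by (intro mult_left_mono add_mono) auto
      also have "\<dots> = G" by (simp add: G_def)
      finally show ?thesis .
    qed
    have cont_g: "continuous_on UNIV g"
      unfolding g_def[abs_def] by (intro continuous_intros cont cont_q)
    have f: "f = (\<lambda>y. g y + q y)" by (simp add: g_def)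
    have "FFB_coeff K f m n - FB_coeff f m n = FFB_coeff K g m n - FB_coeff g m n"
      using exact unfolding FFB_exact_def
      by (subst (1 2) f) (simp add: FFB_coeff_add FB_coeff_add[OF cont_g cont_q])
    also have "norm \<dots> \<le> norm (FFB_coeff K g m n) + norm (FB_coeff g m n)"
      by (rule norm_triangle_ineq4)
    also have "\<dots> \<le> 4 * C * G + D * G"
    proof (rule add_mono)
      show "norm (FFB_coeff K g m n) \<le> 4 * C * G"
        by (rule norm_FFB_coeff_le[OF C(2) C(1) G approx])
      have "y \<in> ?Q" if "norm y \<le> 1" for y :: "real \<times> real"
        using that norm_fst_le[of "fst y" "snd y"] norm_snd_le[of "snd y" "fst y"] by (auto simp: mem_Times_iff)
      then show "norm (FB_coeff g m n) \<le> D * G"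
        unfolding D_def by (intro norm_FB_coeff_le cont_g G approx)
    qed
    also have "\<dots> = (4 * C + D) * (B * pi) / real K" using K by (simp add: G_def field_simps)
    finally show ?thesis .
  qed
  then show ?thesis using B C D by (intro exI[of _ "(4 * C + D) * (B * pi)"]) auto
qed

lemma norm_Psi_le: "norm (Psi m n x) \<le> 1 / (sqrt pi * \<bar>bessel_J (m + 1) (bessel_zero m n)\<bar>)"
  using abs_bessel_J_le[of m "bessel_zero m n * norm x"]
  by (auto simp: Psi_def Psi_polar_def norm_mult norm_divide abs_mult intro!: divide_right_mono)

theorem corollary3p11:
  fixes f :: "real \<times> real \<Rightarrow> complex" and M N :: nat
  assumes "C_class 2 f"
    and "supp f \<subseteq> ball 0 1"
    and "M \<ge> 1" and "N \<ge> 1"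
  shows "\<exists>A::real. A > 0 \<and>
    (\<forall>K::nat. K \<ge> 1 \<longrightarrow> int K \<ge> K_max M N \<longrightarrow>
       sup_norm (\<lambda>x. FFB_sum K M N f x - FB_sum M N f x) \<le> ennreal (A / real K))"
proof -
  define p where "p m n = 1 / (sqrt pi * \<bar>bessel_J (m + 1) (bessel_zero m n)\<bar>)" for m n
  have p: "p m n \<ge> 0" for m n by (simp add: p_def)
  have "\<forall>m n. \<exists>A\<ge>0. n \<ge> 1 \<longrightarrow> (\<forall>K\<ge>1. norm (FFB_coeff K f m n - FB_coeff f m n) \<le> A / real K)"
    using FFB_coeff_error[OF assms(1,2)] by (metis order_refl)
  then obtain a where a: "\<And>m n. a m n \<ge> 0"
    "\<And>m n K. n \<ge> 1 \<Longrightarrow> K \<ge> 1 \<Longrightarrow> norm (FFB_coeff K f m n - FB_coeff f m n) \<le> a m n / real K"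
    by metis
  define A where "A = 1 + (\<Sum>m = - int M..int M. \<Sum>n = 1..N. a m n * p m n)"
  have "A > 0" unfolding A_def by (intro add_pos_nonneg sum_nonneg mult_nonneg_nonneg a p) auto
  moreover have "sup_norm (\<lambda>x. FFB_sum K M N f x - FB_sum M N f x) \<le> ennreal (A / real K)" if K: "K \<ge> 1" for K
    unfolding sup_norm_def
  proof (intro SUP_least ennreal_leI)
    fix x
    have "FFB_sum K M N f x - FB_sum M N f x =
      (\<Sum>m = - int M..int M. \<Sum>n = 1..N. (FFB_coeff K f m n - FB_coeff f m n) * Psi m n x)"
      by (simp add: FFB_sum_def FB_sum_def sum_subtractf left_diff_distrib)
    also have "norm \<dots> \<le> (\<Sum>m = - int M..int M. \<Sum>n = 1..N. a m n / real K * p m n)"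
    proof (intro sum_norm_le)
      fix m n assume "n \<in> {1..N}"
      then show "norm ((FFB_coeff K f m n - FB_coeff f m n) * Psi m n x) \<le> a m n / real K * p m n"
        unfolding norm_mult using norm_Psi_le[of m n x, folded p_def] a(2)[of n K m] a(1)[of m n] K
        by (intro mult_mono) auto
    qed
    also have "\<dots> = (A - 1) / real K"
      by (simp add: A_def sum_divide_distrib)
    also have "\<dots> \<le> A / real K" by (simp add: divide_right_mono)
    finally show "norm (FFB_sum K M N f x - FB_sum M N f x) \<le> A / real K" .
  qed
  ultimately show ?thesis by blast
qed

end
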